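(* Let $\Gamma$ be a finite group of order $k\ge 2$, and let $D$ be a $d$-regular digraph with an edge-labelling $w:E(D)\to\Gamma$. If $d\ge 50k$, then $D$ contains at least $\dfrac{d^2}{100k}$ pairwise edge-disjoint zero-sum directed cycles.
   Context: All digraphs are finite, nonempty, simple and loopless: for each ordered pair $(u,v)$ there is at most one edge from $u$ to $v$, there are no edges from a vertex to itself, and both opposite edges $uv$ and $vu$ may be present. A digraph is $d$-regular if every vertex has outdegree $d$ and indegree $d$. A directed cycle $C=v_1v_2\cdots v_\ell v_1$ has distinct vertices $v_1,\dots,v_\ell$ and all displayed edges in $D$ (so $\ell\ge 2$); cycles differing by cyclic rotation are the same. $\Gamma$ is written multiplicatively with identity $1_\Gamma$ and need not be abelian. The ordered label product of $C$ is $w(C)=w(v_1v_2)w(v_2v_3)\cdots w(v_\ell v_1)$; $C$ is zero-sum if $w(C)=1_\Gamma$ (independent of the choice of initial vertex). *)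

theory Defs
  imports "HOL-Algebra.Coset" "Graph_Theory.Graph_Theory"
begin

definition regular_digraph :: "nat \<Rightarrow> ('v, 'e) pre_digraph \<Rightarrow> bool" where
  "regular_digraph d D \<longleftrightarrow> (\<forall>v \<in> verts D. out_degree D v = d \<and> in_degree D v = d)"

definition label_product :: "('g, 'm) monoid_scheme \<Rightarrow> ('e \<Rightarrow> 'g) \<Rightarrow> 'e awalk \<Rightarrow> 'g" where
  "label_product \<Gamma> w p = foldr (\<lambda>x y. x \<otimes>\<^bsub>\<Gamma>\<^esub> y) (map w p) \<one>\<^bsub>\<Gamma>\<^esub>"

text \<open>
  A directed cycle is given by its arc list, in the sense of \<^const>\<open>pre_digraph.cycle\<close>
  (closed, nonempty, no repeated vertex except that the last equals the first); in a loopfree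
  digraph such a list has length at least 2. Rotations of the list describe the same cycle;
  whether the product is the identity does not depend on the rotation.
\<close>
definition zero_sum_cycle ::
  "('g, 'm) monoid_scheme \<Rightarrow> ('v, 'e) pre_digraph \<Rightarrow> ('e \<Rightarrow> 'g) \<Rightarrow> 'e awalk \<Rightarrow> bool" where
  "zero_sum_cycle \<Gamma> D w p \<longleftrightarrow> pre_digraph.cycle D p \<and> label_product \<Gamma> w p = \<one>\<^bsub>\<Gamma>\<^esub>"

text \<open>
  Rotations of a cycle share all their (at least one) arcs, so an arc-disjoint set of arc lists
  contains at most one representative of each cycle and its cardinality counts cycles.
\<close>
definition arc_disjoint :: "'e awalk set \<Rightarrow> bool" where
  "arc_disjoint F \<longleftrightarrow> pairwise (\<lambda>p q. set p \<inter> set q = {}) F"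

end

theory Submission
  imports "HOL-Combinatorics.Cycles" "HOL-Computational_Algebra.Fundamental_Theorem_Algebra"
    "Jordan_Normal_Form.Determinant" Defs
begin

text \<open>
  Call a permutation of the vertices along arcs a cycle factor. By Gurvits' capacity argument the
  adjacency matrix of a \<open>d\<close>-regular digraph on \<open>n\<close> vertices has at least \<open>(d/e)\<^sup>n\<close> cycle
  factors. Let \<open>z(\<sigma>)\<close> be the number of zero-sum cycles of a cycle factor \<open>\<sigma>\<close>, and \<open>N = t k\<close>.
  The sum of \<open>(1 - N)\<^bsup>z(\<sigma>)\<^esup>\<close> over all cycle factors is, up to sign, a coefficient of
  \<open>det (1 + x M)\<close>, where \<open>M\<close> is the adjacency matrix with every arc weighted by the matrix of its
  label in a representation of trace \<open>N - 1\<close> at the identity and \<open>- 1\<close> elsewhere; averaging over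
  phases and Hadamard's inequality bound this sum by \<open>(e d N)\<^bsup>n/2\<^esup>\<close>. If every \<open>z(\<sigma>)\<close> were
  less than \<open>T = \<lfloor>d/(25k)\<rfloor>\<close>, then finite differences in \<open>t = 0, \<dots>, T\<close> would give at most
  \<open>2\<^sup>T (e d T k)\<^bsup>n/2\<^esup>\<close> cycle factors, which is too few. So some cycle factor contains \<open>T\<close>
  zero-sum cycles. Removing it leaves a \<open>(d - 1)\<close>-regular digraph, and summing over
  \<open>d, d - 1, \<dots>, 1\<close> gives \<open>d\<^sup>2/(100k)\<close> cycles.
\<close>

section \<open>Permanents of doubly stochastic matrices\<close>

text \<open>The trace \<open>- 1\<close> is forced by signs: a permutation's sign is the product of
  \<open>(- 1) ^ (length cs + 1)\<close> over its cycles, so every cycle that is not zero-sum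
  contributes \<open>(- 1) ^ length cs\<close>, and the signs of all cycle factors collapse to one
  global sign. What remains is a polynomial in \<open>t\<close> whose value at \<open>t = 0\<close>
  counts the cycle factors. No determinant gives that value, since the representation exists only
  for \<open>t > 0\<close>; it has to be extrapolated from \<open>t = 1, ..., T\<close>, which costs
  only \<open>2 ^ T\<close>, while Hadamard's inequality saves a square root against the trivial
  count \<open>d ^ n\<close>.

  After squaring, \<open>(d / e) ^ (2 * n)\<close> meets \<open>4 ^ T * (e * d * T * k) ^ n\<close>,
  so the comparison is decided by \<open>d\<close> against \<open>e ^ 3 * T * k\<close>. As
  \<open>e ^ 3\<close> is about 20.1, the constant 25 leaves a factor 9/10 per vertex, and this
  beats \<open>4 ^ T\<close> because \<open>n >= d >= 50 * T\<close>. With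
  \<open>c = 25 * k\<close>, the sum of the quotients \<open>x div c\<close> for
  \<open>x <= d\<close> is about \<open>d ^ 2 / (2 * c)\<close>; the final constant 100 = 4 * 25
  gives away a factor 2 to absorb the rounding.\<close>

lemma coeff_prod_linear:
  fixes r :: "nat \<Rightarrow> 'a::field"
  assumes "\<forall>i<m. r i \<noteq> 0"
  shows "coeff (\<Prod>i<m. [:- r i, 1:]) 0 = (\<Prod>i<m. - r i) \<and>
    coeff (\<Prod>i<m. [:- r i, 1:]) 1 = (\<Prod>i<m. - r i) * (\<Sum>i<m. - 1 / r i)"
  using assms
proof (induction m)
  case (Suc m)
  have "r m \<noteq> 0" using Suc.prems by auto
  then show ?case using Suc by (auto simp: field_simps)
qed auto

text \<open>The quotient of the two lowest coefficients is the logarithmic derivative at 0, hence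
  the sum of \<open>- 1 / r i\<close>. Both half-plane lemmas below rest on this form.\<close>

lemma coeff_of_roots:
  fixes p :: "complex poly"
  assumes "p \<noteq> 0" "\<And>z. poly p z = 0 \<Longrightarrow> z \<noteq> 0"
  obtains r where "p = Polynomial.smult (lead_coeff p) (\<Prod>i<degree p. [:- r i, 1:])"
    "\<And>i. i < degree p \<Longrightarrow> poly p (r i) = 0"
    "coeff p 1 = coeff p 0 * (\<Sum>i<degree p. - 1 / r i)"
    "coeff p 0 = lead_coeff p * (\<Prod>i<degree p. - r i)"
proof -
  obtain r where r: "Polynomial.smult (lead_coeff p) (\<Prod>i<degree p. [:- r i, 1:]) = p"
    by (rule complex_poly_decompose')
  have root: "poly p (r i) = 0" if "i < degree p" for i
    using that by (subst r[symmetric]) (auto simp: poly_prod)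
  then have nz: "\<forall>i<degree p. r i \<noteq> 0" using assms(2) by auto
  define q where "q = (\<Prod>i<degree p. [:- r i, 1:])"
  have p: "p = Polynomial.smult (lead_coeff p) q" using r by (simp add: q_def)
  note c = coeff_prod_linear[OF nz, folded q_def]
  have c0: "coeff p 0 = lead_coeff p * (\<Prod>i<degree p. - r i)"
    by (subst p) (simp add: c)
  have c1: "coeff p 1 = lead_coeff p * coeff q 1"
    by (subst p) (simp only: coeff_smult)
  show ?thesis
    by (rule that[of r]) (use r root c0 c c1 in auto)
qed

text \<open>Gauss-Lucas at the point 0: the map from \<open>z\<close> to \<open>- 1 / z\<close>
  sends the left half plane to the right one, so the logarithmic derivative at 0 has positive real
  part.\<close>

lemma coeff_1_neq_0_of_roots_left:
  fixes p :: "complex poly"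
  assumes "degree p > 0" and roots: "\<And>z. poly p z = 0 \<Longrightarrow> Re z < 0"
  shows "coeff p 1 \<noteq> 0"
proof -
  have "p \<noteq> 0" using assms by auto
  have "\<And>z. poly p z = 0 \<Longrightarrow> z \<noteq> 0" using roots by force
  from coeff_of_roots[OF \<open>p \<noteq> 0\<close> this] obtain r where
    r: "\<And>i. i < degree p \<Longrightarrow> poly p (r i) = 0"
       "coeff p 1 = coeff p 0 * (\<Sum>i<degree p. - 1 / r i)" by metis
  have "coeff p 0 \<noteq> 0" using roots[of 0] by (auto simp: poly_0_coeff_0)
  moreover have "Re (\<Sum>i<degree p. - 1 / r i) > 0"
    unfolding Re_sum
  proof (rule sum_pos)
    fix i assume "i \<in> {..<degree p}"
    then have neg: "Re (r i) < 0" using r roots by auto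
    then have "(Re (r i))\<^sup>2 + (Im (r i))\<^sup>2 > 0" by (simp add: add_pos_nonneg)
    then show "0 < Re (- 1 / r i)" using neg by (auto simp: Re_divide divide_neg_pos)
  qed (use assms in auto)
  then have "(\<Sum>i<degree p. - 1 / r i) \<noteq> 0" by (metis less_irrefl zero_complex.sel(1))
  ultimately show ?thesis using r(2) by simp
qed

text \<open>For a root \<open>- s\<close> the factor obeys \<open>t + s <= s * exp (t / s)\<close>.
  The product of the \<open>s\<close> is the norm of the constant coefficient, and the sum of the
  \<open>1 / s\<close> is the logarithmic derivative at 0.\<close>

lemma poly_le_exp_of_negative_roots:
  fixes p :: "complex poly"
  assumes "p \<noteq> 0" and roots: "\<And>z. poly p z = 0 \<Longrightarrow> Im z = 0 \<and> Re z < 0" and "t \<ge> 0"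
  shows "norm (poly p (of_real t)) \<le> norm (coeff p 0) * exp (t * Re (coeff p 1 / coeff p 0))"
proof -
  have "\<And>z. poly p z = 0 \<Longrightarrow> z \<noteq> 0" using roots by force
  from coeff_of_roots[OF \<open>p \<noteq> 0\<close> this] obtain r where
    p: "p = Polynomial.smult (lead_coeff p) (\<Prod>i<degree p. [:- r i, 1:])"
    and r: "\<And>i. i < degree p \<Longrightarrow> poly p (r i) = 0"
       "coeff p 1 = coeff p 0 * (\<Sum>i<degree p. - 1 / r i)"
       "coeff p 0 = lead_coeff p * (\<Prod>i<degree p. - r i)" by metis
  define s where "s i = - Re (r i)" for i
  have s: "s i > 0" "r i = of_real (- s i)" if "i < degree p" for i
    using roots[OF r(1)[OF that]] by (auto simp: s_def complex_eq_iff)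
  have c0: "coeff p 0 \<noteq> 0" using roots[of 0] by (auto simp: poly_0_coeff_0)
  have ratio: "coeff p 1 / coeff p 0 = of_real (\<Sum>i<degree p. 1 / s i)"
    using c0 r(2) by (simp add: s)
  have "norm (poly p (of_real t)) = norm (lead_coeff p) * (\<Prod>i<degree p. norm (of_real t - r i))"
    by (subst p) (simp add: poly_prod norm_mult prod_norm)
  also have "\<dots> \<le> norm (lead_coeff p) * (\<Prod>i<degree p. s i * exp (t * (1 / s i)))"
  proof (intro mult_left_mono prod_mono conjI)
    fix i assume "i \<in> {..<degree p}"
    then have si: "s i > 0" "r i = of_real (- s i)" using s by auto
    have "norm (of_real t - r i) = t + s i"
      using si \<open>t \<ge> 0\<close> by (simp flip: of_real_add)
    also have "\<dots> = s i * (1 + t * (1 / s i))" using si by (simp add: field_simps)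
    also have "\<dots> \<le> s i * exp (t * (1 / s i))"
      using si by (intro mult_left_mono exp_ge_add_one_self) auto
    finally show "norm (of_real t - r i) \<le> s i * exp (t * (1 / s i))" .
  qed auto
  also have "\<dots> = norm (lead_coeff p) * (\<Prod>i<degree p. s i) * exp (t * (\<Sum>i<degree p. 1 / s i))"
    by (simp add: prod.distrib exp_sum sum_distrib_left)
  also have "norm (lead_coeff p) * (\<Prod>i<degree p. s i) = norm (coeff p 0)"
    unfolding r(3) using s by (auto simp: norm_mult prod_norm[symmetric] less_imp_le intro!: prod.cong)
  finally show ?thesis unfolding ratio by simp
qed

section \<open>Mixed derivatives of products of linear forms\<close>

text \<open>
  The product of the linear forms \<open>\<Sum>j. a i j * x j\<close>, differentiated once in each variable outside
  \<open>U\<close> and evaluated at \<open>0\<close> in these variables.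
\<close>

definition mixed_part :: "'v set \<Rightarrow> ('v \<Rightarrow> 'v \<Rightarrow> 'a::comm_ring_1) \<Rightarrow> 'v set \<Rightarrow> ('v \<Rightarrow> 'a) \<Rightarrow> 'a" where
  "mixed_part V a U x = (\<Sum>\<phi> | \<phi> \<in> V \<rightarrow>\<^sub>E V \<and> (\<forall>j\<in>V - U. card {i \<in> V. \<phi> i = j} = 1).
     \<Prod>i\<in>V. a i (\<phi> i) * (if \<phi> i \<in> U then x (\<phi> i) else 1))"

lemma mixed_part_cong:
  "(\<And>j. j \<in> U \<Longrightarrow> x j = y j) \<Longrightarrow> mixed_part V a U x = mixed_part V a U y"
  unfolding mixed_part_def by (intro sum.cong prod.cong refl) auto

lemma mixed_part_full:
  assumes "finite V"
  shows "mixed_part V a V x = (\<Prod>i\<in>V. \<Sum>j\<in>V. a i j * x j)"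
  unfolding mixed_part_def using assms
  by (subst prod_sum_PiE) (auto intro!: sum.cong prod.cong simp: PiE_iff extensional_def)

text \<open>Once every variable has been differentiated, each vertex is hit exactly once and the
  permanent remains.\<close>

lemma mixed_part_empty:
  assumes "finite V"
  shows "mixed_part V a {} x = (\<Sum>\<sigma> | \<sigma> permutes V. \<Prod>i\<in>V. a i (\<sigma> i))"
  unfolding mixed_part_def
proof (rule sum.reindex_bij_witness[of _ "\<lambda>\<sigma>. restrict \<sigma> V" "\<lambda>\<phi> v. if v \<in> V then \<phi> v else v"])
  fix \<phi> assume *: "\<phi> \<in> {\<phi> \<in> V \<rightarrow>\<^sub>E V. \<forall>j\<in>V - {}. card {i \<in> V. \<phi> i = j} = 1}"
  have im: "\<phi> v \<in> V" if "v \<in> V" for v using * that by auto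
  have one: "card {i \<in> V. \<phi> i = j} = 1" if "j \<in> V" for j using * that by auto
  have "inj_on \<phi> V"
  proof (rule inj_onI)
    fix u v assume uv: "u \<in> V" "v \<in> V" "\<phi> u = \<phi> v"
    from one[OF im[OF uv(2)]] obtain z where "{i \<in> V. \<phi> i = \<phi> v} = {z}"
      by (metis card_1_singletonE)
    then have "u \<in> {z}" "v \<in> {z}" using uv by blast+
    then show "u = v" by simp
  qed
  then have "bij_betw \<phi> V V"
    using assms im by (simp add: bij_betw_def endo_inj_surj image_subset_iff)
  then have "bij_betw (\<lambda>v. if v \<in> V then \<phi> v else v) V V"
    by (rule bij_betw_cong[THEN iffD1, rotated]) simp
  then show "(\<lambda>v. if v \<in> V then \<phi> v else v) \<in> {\<sigma>. \<sigma> permutes V}"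
    by (auto intro!: bij_imp_permutes)
  show "restrict (\<lambda>v. if v \<in> V then \<phi> v else v) V = \<phi>"
    using * by (auto simp: fun_eq_iff PiE_def extensional_def)
  show "(\<Prod>i\<in>V. a i (if i \<in> V then \<phi> i else i)) =
    (\<Prod>i\<in>V. a i (\<phi> i) * (if \<phi> i \<in> {} then x (\<phi> i) else 1))"
    by (intro prod.cong) auto
next
  fix \<sigma> assume "\<sigma> \<in> {\<sigma>. \<sigma> permutes V}"
  then have \<sigma>: "\<sigma> permutes V" by simp
  show "(\<lambda>v. if v \<in> V then restrict \<sigma> V v else v) = \<sigma>"
    using \<sigma> by (auto simp: fun_eq_iff permutes_not_in)
  have "card {i \<in> V. \<sigma> i = j} = 1" if "j \<in> V" for j
  proof -
    have "{i \<in> V. \<sigma> i = j} = {inv_into UNIV \<sigma> j}"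
      using that \<sigma> permutes_inverses[OF \<sigma>] permutes_in_image[OF permutes_inv[OF \<sigma>]] by force
    then show ?thesis by simp
  qed
  moreover have "{i \<in> V. restrict \<sigma> V i = j} = {i \<in> V. \<sigma> i = j}" for j by auto
  ultimately show "restrict \<sigma> V \<in> {\<phi> \<in> V \<rightarrow>\<^sub>E V. \<forall>j\<in>V - {}. card {i \<in> V. \<phi> i = j} = 1}"
    using permutes_in_image[OF \<sigma>] by auto
qed

text \<open>There are \<open>card V\<close> factors and every vertex outside \<open>U\<close> takes
  exactly one, so \<open>card U\<close> are left for \<open>U\<close>. This is the degree count
  behind homogeneity.\<close>

lemma card_fibres_over:
  assumes "finite V" "U \<subseteq> V" "\<phi> \<in> V \<rightarrow>\<^sub>E V" "\<forall>j\<in>V - U. card {i \<in> V. \<phi> i = j} = 1"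
  shows "card {i \<in> V. \<phi> i \<in> U} = card U"
proof -
  have fin: "finite U" using assms finite_subset by auto
  have "card V = (\<Sum>j\<in>V. card {i \<in> V. \<phi> i = j})"
    using sum.group[of V V \<phi> "\<lambda>_. 1::nat"] assms(1,3) by (simp add: image_subset_iff PiE_iff)
  also have "\<dots> = (\<Sum>j\<in>V - U. card {i \<in> V. \<phi> i = j}) + (\<Sum>j\<in>U. card {i \<in> V. \<phi> i = j})"
    using assms by (intro sum.subset_diff) auto
  also have "(\<Sum>j\<in>V - U. card {i \<in> V. \<phi> i = j}) = card (V - U)" using assms(4) by simp
  also have "(\<Sum>j\<in>U. card {i \<in> V. \<phi> i = j}) = card {i \<in> V. \<phi> i \<in> U}"
  proof -
    have "(\<Sum>j\<in>U. card {i \<in> {i \<in> V. \<phi> i \<in> U}. \<phi> i = j}) = card {i \<in> V. \<phi> i \<in> U}"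
      using sum.group[of "{i \<in> V. \<phi> i \<in> U}" U \<phi> "\<lambda>_. 1::nat"] fin assms(1)
      by (simp add: image_subset_iff)
    moreover have "{i \<in> {i \<in> V. \<phi> i \<in> U}. \<phi> i = j} = {i \<in> V. \<phi> i = j}" if "j \<in> U" for j
      using that by auto
    ultimately show ?thesis by simp
  qed
  also have "card (V - U) = card V - card U" using assms fin by (simp add: card_Diff_subset)
  finally show ?thesis using card_mono[OF assms(1,2)] by linarith
qed

lemma mixed_part_homogeneous:
  assumes "finite V" "U \<subseteq> V"
  shows "mixed_part V a U (\<lambda>j. c * x j) = c ^ card U * mixed_part V a U x"
  unfolding mixed_part_def sum_distrib_left
proof (rule sum.cong[OF refl])
  fix \<phi> assume *: "\<phi> \<in> {\<phi> \<in> V \<rightarrow>\<^sub>E V. \<forall>j\<in>V - U. card {i \<in> V. \<phi> i = j} = 1}"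
  have "c ^ card U = (\<Prod>i\<in>V. if \<phi> i \<in> U then c else 1)"
    using card_fibres_over[OF assms, of \<phi>] * assms(1) by (simp add: prod.If_cases Int_def)
  then show "(\<Prod>i\<in>V. a i (\<phi> i) * (if \<phi> i \<in> U then c * x (\<phi> i) else 1)) =
    c ^ card U * (\<Prod>i\<in>V. a i (\<phi> i) * (if \<phi> i \<in> U then x (\<phi> i) else 1))"
    by (auto simp flip: prod.distrib intro!: prod.cong)
qed

text \<open>As a function of the single variable \<open>x j\<close>, the linear coefficient is the
  derivative at 0, that is, the next mixed derivative. The coefficient of the full degree
  \<open>card U\<close> collects the terms in which all remaining factors pick \<open>j\<close>,
  which are those surviving at the unit vector of \<open>j\<close>.\<close>

lemma mixed_part_slice:
  fixes a :: "'v \<Rightarrow> 'v \<Rightarrow> 'a::idom"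
  assumes "finite V" "U \<subseteq> V" "j \<in> U"
  obtains R where "\<And>t. mixed_part V a U (x(j := t)) = poly R t"
    "coeff R 1 = mixed_part V a (U - {j}) x"
    "coeff R (card U) = mixed_part V a U ((\<lambda>_. 0)(j := 1))"
proof
  let ?\<Phi> = "\<lambda>U. {\<phi> \<in> V \<rightarrow>\<^sub>E V. \<forall>j\<in>V - U. card {i \<in> V. \<phi> i = j} = 1}"
  let ?c = "\<lambda>\<phi>. \<Prod>i\<in>V. a i (\<phi> i) * (if \<phi> i \<in> U - {j} then x (\<phi> i) else 1)"
  let ?m = "\<lambda>\<phi>. card {i \<in> V. \<phi> i = j}"
  define R where "R = (\<Sum>\<phi>\<in>?\<Phi> U. monom (?c \<phi>) (?m \<phi>))"
  have fin: "finite (?\<Phi> U)" for U using assms(1) by (intro finite_Collect_conjI disjI1) (auto simp: finite_PiE)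
  show "mixed_part V a U (x(j := t)) = poly R t" for t
    unfolding mixed_part_def R_def poly_sum poly_monom
  proof (rule sum.cong[OF refl])
    fix \<phi>
    have "t ^ ?m \<phi> = (\<Prod>i\<in>V. if \<phi> i = j then t else 1)"
      using assms(1) by (simp add: prod.If_cases Int_def)
    then show "(\<Prod>i\<in>V. a i (\<phi> i) * (if \<phi> i \<in> U then (x(j := t)) (\<phi> i) else 1)) = ?c \<phi> * t ^ ?m \<phi>"
      using assms(3) by (auto simp flip: prod.distrib intro!: prod.cong)
  qed
  have "coeff R 1 = (\<Sum>\<phi>\<in>?\<Phi> U. if ?m \<phi> = 1 then ?c \<phi> else 0)"
    unfolding R_def coeff_sum coeff_monom by (intro sum.cong) auto
  also have "\<dots> = (\<Sum>\<phi>\<in>?\<Phi> (U - {j}). ?c \<phi>)"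
    using assms by (intro sum.mono_neutral_cong_right fin) auto
  finally show "coeff R 1 = mixed_part V a (U - {j}) x" by (simp add: mixed_part_def)
  have "coeff R (card U) = (\<Sum>\<phi>\<in>?\<Phi> U. if ?m \<phi> = card U then ?c \<phi> else 0)"
    unfolding R_def coeff_sum coeff_monom by (intro sum.cong) auto
  also have "\<dots> = mixed_part V a U ((\<lambda>_. 0)(j := 1))"
    unfolding mixed_part_def
  proof (rule sum.cong[OF refl])
    fix \<phi> assume \<phi>: "\<phi> \<in> ?\<Phi> U"
    then have cU: "card {i \<in> V. \<phi> i \<in> U} = card U" using card_fibres_over[OF assms(1,2)] by auto
    have sub: "{i \<in> V. \<phi> i = j} \<subseteq> {i \<in> V. \<phi> i \<in> U}" using assms(3) by auto
    show "(if ?m \<phi> = card U then ?c \<phi> else 0) =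
      (\<Prod>i\<in>V. a i (\<phi> i) * (if \<phi> i \<in> U then ((\<lambda>_. 0)(j := 1)) (\<phi> i) else 1))"
    proof (cases "?m \<phi> = card U")
      case True
      then have "{i \<in> V. \<phi> i = j} = {i \<in> V. \<phi> i \<in> U}"
        using cU assms(1) by (intro card_subset_eq[OF _ sub]) auto
      then have "\<phi> i \<in> U \<Longrightarrow> \<phi> i = j" if "i \<in> V" for i using that by blast
      then show ?thesis using True by (auto intro!: prod.cong)
    next
      case False
      then have "{i \<in> V. \<phi> i = j} \<noteq> {i \<in> V. \<phi> i \<in> U}" using cU by auto
      then obtain i where "i \<in> V" "\<phi> i \<in> U" "\<phi> i \<noteq> j" using sub by blast
      then have "(\<Prod>i\<in>V. a i (\<phi> i) * (if \<phi> i \<in> U then ((\<lambda>_. 0)(j := 1)) (\<phi> i) else 1)) = 0"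
        using assms(1) by (intro prod_zero) auto
      then show ?thesis using False by simp
    qed
  qed
  finally show "coeff R (card U) = mixed_part V a U ((\<lambda>_. 0)(j := 1))" .
qed

text \<open>Stronger than the usual stability, which only forbids zeros with all real parts
  positive: real parts may vanish as long as one of them does not. Setting a variable to 0 and
  evaluating at unit vectors thus stay inside the domain, and no limit argument is needed. The price
  is that the entries of the matrix must be positive.\<close>

definition strictly_stable :: "'v set \<Rightarrow> (('v \<Rightarrow> complex) \<Rightarrow> complex) \<Rightarrow> bool" where
  "strictly_stable U f \<longleftrightarrow> (\<forall>x. (\<forall>j\<in>U. Re (x j) \<ge> 0) \<and> (\<exists>j\<in>U. Re (x j) > 0) \<longrightarrow> f x \<noteq> 0)"

lemma strictly_stable_mixed_part_full:
  assumes "finite V" "\<And>i j. i \<in> V \<Longrightarrow> j \<in> V \<Longrightarrow> a i j > (0::real)"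
  shows "strictly_stable V (mixed_part V (\<lambda>i j. of_real (a i j)) V)"
  unfolding strictly_stable_def
proof (intro allI impI)
  fix x :: "'a \<Rightarrow> complex"
  assume x: "(\<forall>j\<in>V. 0 \<le> Re (x j)) \<and> (\<exists>j\<in>V. 0 < Re (x j))"
  then obtain j where j: "j \<in> V" "0 < Re (x j)" by auto
  have "Re (\<Sum>j\<in>V. of_real (a i j) * x j) > 0" if "i \<in> V" for i
    unfolding Re_sum
    using assms that x j by (intro sum_pos2[of V j]) (auto intro!: mult_nonneg_nonneg less_imp_le[of 0 "a i _"])
  then have "(\<Sum>j\<in>V. of_real (a i j) * x j) \<noteq> 0" if "i \<in> V" for i using that by fastforce
  then show "mixed_part V (\<lambda>i j. of_real (a i j)) V x \<noteq> 0"
    using assms(1) by (simp add: mixed_part_full)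
qed

lemma strictly_stable_slice_roots:
  assumes "strictly_stable U f" "j \<in> U" "\<And>t. f (x(j := t)) = poly R t"
    and "\<forall>i\<in>U - {j}. Re (x i) \<ge> 0" "\<exists>i\<in>U - {j}. Re (x i) > 0" "poly R z = 0"
  shows "Re z < 0"
proof (rule ccontr)
  assume "\<not> Re z < 0"
  then have "(\<forall>i\<in>U. Re ((x(j := z)) i) \<ge> 0) \<and> (\<exists>i\<in>U. Re ((x(j := z)) i) > 0)"
    using assms by auto
  then have "f (x(j := z)) \<noteq> 0" using assms(1) unfolding strictly_stable_def by blast
  then show False using assms(3,6) by simp
qed

text \<open>The slice in \<open>x j\<close> has all its roots in the open left half plane, and it is
  not constant since its coefficient of degree \<open>card U\<close> is a value at a unit vector.
  Gauss-Lucas then keeps its derivative at 0 away from zero.\<close>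

lemma strictly_stable_mixed_part_step:
  assumes "finite V" "U \<subseteq> V" "j \<in> U" "strictly_stable U (mixed_part V a U)"
  shows "strictly_stable (U - {j}) (mixed_part V a (U - {j}))"
  unfolding strictly_stable_def
proof (intro allI impI, elim conjE)
  fix x :: "'a \<Rightarrow> complex"
  assume x: "\<forall>i\<in>U - {j}. 0 \<le> Re (x i)" "\<exists>i\<in>U - {j}. 0 < Re (x i)"
  obtain R where R: "\<And>t. mixed_part V a U (x(j := t)) = poly R t"
    "coeff R 1 = mixed_part V a (U - {j}) x"
    "coeff R (card U) = mixed_part V a U ((\<lambda>_. 0)(j := 1))"
    using mixed_part_slice[OF assms(1-3)] by metis
  have "coeff R (card U) \<noteq> 0"
    unfolding R(3) using assms(3,4) unfolding strictly_stable_def by (auto intro!: bexI[of _ j])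
  moreover have "card U > 0" using assms finite_subset by (auto simp: card_gt_0_iff)
  ultimately have "degree R > 0" using le_degree[of R "card U"] by simp
  from coeff_1_neq_0_of_roots_left[OF this strictly_stable_slice_roots[OF assms(4,3) R(1) x]]
  show "mixed_part V a (U - {j}) x \<noteq> 0" using R(2) by simp
qed

lemma mixed_part_of_real:
  "mixed_part V (\<lambda>i j. of_real (a i j)) U (\<lambda>i. of_real (x i)) = of_real (mixed_part V a U x)"
  unfolding mixed_part_def by (auto simp: of_real_sum of_real_prod intro!: sum.cong prod.cong)

lemma mixed_part_nonneg:
  fixes a :: "'v \<Rightarrow> 'v \<Rightarrow> real"
  assumes "\<And>i j. i \<in> V \<Longrightarrow> j \<in> V \<Longrightarrow> a i j \<ge> 0" "\<And>j. j \<in> U \<Longrightarrow> x j \<ge> 0"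
  shows "mixed_part V a U x \<ge> 0"
  unfolding mixed_part_def using assms by (intro sum_nonneg prod_nonneg) (auto simp: PiE_iff)

text \<open>Gurvits' inequality: one differentiation costs at most a factor \<open>exp 1\<close> of
  the capacity. The slice \<open>R\<close> has real negative roots at positive arguments, so
  \<open>R(t)\<close> lies below \<open>b * exp (t * m / b)\<close> with \<open>b = R(0)\<close> and
  \<open>m = R'(0)\<close>, and above \<open>C * P * t\<close> by the capacity hypothesis.\<close>

lemma mixed_part_capacity_step:
  fixes a :: "'v \<Rightarrow> 'v \<Rightarrow> real"
  assumes fin: "finite V" and U: "U \<subseteq> V" "j \<in> U"
    and a: "\<And>i j. i \<in> V \<Longrightarrow> j \<in> V \<Longrightarrow> a i j \<ge> 0"
    and st: "strictly_stable U (mixed_part V (\<lambda>i j. complex_of_real (a i j)) U)"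
    and C: "C > 0" and cap: "\<And>x. (\<And>i. x i > 0) \<Longrightarrow> mixed_part V a U x \<ge> C * (\<Prod>i\<in>U. x i)"
    and x: "\<And>i. x i > 0"
  shows "mixed_part V a (U - {j}) x \<ge> C / exp 1 * (\<Prod>i\<in>U - {j}. x i)"
proof (cases "U = {j}")
  case True
  obtain R where R: "coeff R 1 = mixed_part V a (U - {j}) x"
    "coeff R (card U) = mixed_part V a U ((\<lambda>_. 0)(j := 1))"
    using mixed_part_slice[OF fin U] by metis
  have "mixed_part V a (U - {j}) x = mixed_part V a U ((\<lambda>_. 0)(j := 1))"
    using R True by simp
  also have "\<dots> = mixed_part V a U (\<lambda>_. 1)" using True by (intro mixed_part_cong) auto
  also have "\<dots> \<ge> C" using cap[of "\<lambda>_. 1"] by simp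
  finally have "C \<le> mixed_part V a (U - {j}) x" .
  moreover have "C / exp 1 \<le> C / 1" using C by (intro divide_left_mono) auto
  ultimately show ?thesis using True by simp
next
  case False
  let ?a = "\<lambda>i j. complex_of_real (a i j)"
  let ?x = "\<lambda>i. complex_of_real (x i)"
  have finU: "finite U" using fin U finite_subset by auto
  obtain k where k: "k \<in> U - {j}" using False U by auto
  obtain R where R: "\<And>t. mixed_part V ?a U (?x(j := t)) = poly R t"
    "coeff R 1 = mixed_part V ?a (U - {j}) ?x"
    using mixed_part_slice[OF fin U] by metis
  have xr: "?x(j := of_real t) = (\<lambda>i. of_real ((x(j := t)) i))" for t by auto
  have Rt: "poly R (of_real t) = of_real (mixed_part V a U (x(j := t)))" for t
    by (simp only: R(1)[symmetric] xr mixed_part_of_real)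
  have xx: "\<forall>i\<in>U - {j}. 0 \<le> Re (?x i)" "\<exists>i\<in>U - {j}. 0 < Re (?x i)"
    using x k less_imp_le[OF x] by auto
  note neg = strictly_stable_slice_roots[OF st U(2) R(1) xx]
  have R0: "R \<noteq> 0" using neg[of 0] by auto
  have roots: "Im z = 0 \<and> Re z < 0" if z: "poly R z = 0" for z
  proof (rule conjI[OF ccontr neg[OF z]])
    assume im: "Im z \<noteq> 0"
    \<comment> \<open>Multiplication by \<open>u\<close> makes the real part of \<open>z\<close>
      vanish and keeps that of a positive number. By homogeneity a nonreal root would thus give a
      zero in the forbidden region.\<close>
    define u where "u = Complex 1 (Re z / Im z)"
    have "mixed_part V ?a U (\<lambda>i. u * (?x(j := z)) i) = 0"
      by (simp only: mixed_part_homogeneous[OF fin U(1)] R(1) z mult_zero_right)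
    moreover have "Re (u * (?x(j := z)) i) \<ge> 0" for i
      using im less_imp_le[OF x] by (auto simp: u_def)
    moreover have "Re (u * (?x(j := z)) k) > 0" using k x by (auto simp: u_def)
    ultimately have "mixed_part V ?a U (\<lambda>i. u * (?x(j := z)) i) \<noteq> 0"
      using k by (intro st[unfolded strictly_stable_def, rule_format]) blast
    then show False using \<open>mixed_part V ?a U (\<lambda>i. u * (?x(j := z)) i) = 0\<close> by contradiction
  qed
  define b where "b = mixed_part V a U (x(j := 0))"
  define m where "m = mixed_part V a (U - {j}) x"
  define P where "P = (\<Prod>i\<in>U - {j}. x i)"
  have c0: "coeff R 0 = of_real b" using Rt[of 0] by (simp add: b_def poly_0_coeff_0)
  have c1: "coeff R 1 = of_real m" unfolding R(2) mixed_part_of_real m_def ..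
  have "b \<noteq> 0" using neg[of 0] c0 by (auto simp: poly_0_coeff_0)
  moreover have "b \<ge> 0" unfolding b_def using a less_imp_le[OF x] by (intro mixed_part_nonneg) auto
  ultimately have b: "b > 0" by simp
  have m: "m \<ge> 0" unfolding m_def using a less_imp_le[OF x] by (intro mixed_part_nonneg) auto
  have P: "P > 0" unfolding P_def using x by (intro prod_pos) auto
  have key: "C * P * t \<le> b * exp (t * (m / b))" if t: "t > 0" for t
  proof -
    have "C * P * t = C * (\<Prod>i\<in>U. (x(j := t)) i)"
      using prod.remove[OF finU U(2), of "x(j := t)"] by (simp add: P_def)
    also have "\<dots> \<le> mixed_part V a U (x(j := t))" using x t by (intro cap) auto
    also have "\<dots> \<le> norm (poly R (of_real t))" unfolding Rt by simp
    also have "\<dots> \<le> norm (coeff R 0) * exp (t * Re (coeff R 1 / coeff R 0))"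
      using poly_le_exp_of_negative_roots[OF R0 roots] t by simp
    also have "\<dots> = b * exp (t * (m / b))" unfolding c0 c1 using b by simp
    finally show ?thesis .
  qed
  have "m \<noteq> 0"
  proof
    assume "m = 0"
    \<comment> \<open>With \<open>m = 0\<close> the linear lower bound would stay below the constant
      \<open>b\<close>; at this argument it equals \<open>b + 1\<close>.\<close>
    moreover have "(b + 1) / (C * P) > 0" using b C P by simp
    ultimately have "C * P * ((b + 1) / (C * P)) \<le> b" using key[of "(b + 1) / (C * P)"] by simp
    then show False using C P by simp
  qed
  then have "m > 0" using m by simp
  \<comment> \<open>The point \<open>t = b / m\<close> minimises
    \<open>b * exp (t * m / b) / t\<close>.\<close>
  then have "C * P * (b / m) \<le> b * exp 1" using key[of "b / m"] b by simp
  then have "C / exp 1 * P \<le> m" using b \<open>m > 0\<close> by (simp add: field_simps)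
  then show ?thesis by (simp add: m_def P_def)
qed

lemma mixed_part_capacity:
  fixes a :: "'v \<Rightarrow> 'v \<Rightarrow> real"
  assumes fin: "finite V" and a: "\<And>i j. i \<in> V \<Longrightarrow> j \<in> V \<Longrightarrow> a i j > 0"
    and C: "C > 0" and cap: "\<And>x. (\<And>i. x i > 0) \<Longrightarrow> (\<Prod>i\<in>V. \<Sum>j\<in>V. a i j * x j) \<ge> C * (\<Prod>i\<in>V. x i)"
    and W: "W \<subseteq> V"
  shows "strictly_stable (V - W) (mixed_part V (\<lambda>i j. complex_of_real (a i j)) (V - W)) \<and>
    (\<forall>x. (\<forall>i. x i > 0) \<longrightarrow> mixed_part V a (V - W) x \<ge> C / exp 1 ^ card W * (\<Prod>i\<in>V - W. x i))"
  using finite_subset[OF W fin] W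
proof (induction W)
  case empty
  have "strictly_stable V (mixed_part V (\<lambda>i j. complex_of_real (a i j)) V)"
    using fin a by (intro strictly_stable_mixed_part_full) auto
  moreover have "mixed_part V a V x \<ge> C * (\<Prod>i\<in>V. x i)" if "\<forall>i. x i > 0" for x
    using cap that fin by (simp add: mixed_part_full)
  ultimately show ?case by simp
next
  case (insert j W)
  then have j: "j \<in> V - W" and W: "W \<subseteq> V" by auto
  have eq: "V - insert j W = V - W - {j}" by auto
  note IH = insert.IH[OF W]
  have "strictly_stable (V - W - {j}) (mixed_part V (\<lambda>i j. complex_of_real (a i j)) (V - W - {j}))"
    using IH by (intro strictly_stable_mixed_part_step fin j) auto
  moreover have "mixed_part V a (V - W - {j}) x \<ge> C / exp 1 ^ card W / exp 1 * (\<Prod>i\<in>V - W - {j}. x i)"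
    if "\<forall>i. x i > 0" for x
    using IH C that less_imp_le[OF a] by (intro mixed_part_capacity_step fin j) auto
  ultimately show ?case
    unfolding eq using insert.hyps by (simp add: field_simps)
qed

text \<open>Weighted AM-GM in each row with weights \<open>a i j / s\<close>, obtained from
  \<open>ln u <= u - 1\<close> at \<open>u = s * x j / y i\<close>. After summation over the rows,
  the column sums turn the weights back into one full logarithm per variable.\<close>

lemma prod_row_sums_ge:
  fixes a :: "'v \<Rightarrow> 'v \<Rightarrow> real"
  assumes fin: "finite V" and a: "\<And>i j. i \<in> V \<Longrightarrow> j \<in> V \<Longrightarrow> a i j > 0"
    and row: "\<And>i. i \<in> V \<Longrightarrow> (\<Sum>j\<in>V. a i j) = s"
    and col: "\<And>j. j \<in> V \<Longrightarrow> (\<Sum>i\<in>V. a i j) = s"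
    and s: "s > 0" and x: "\<And>i. x i > 0"
  shows "(\<Prod>i\<in>V. \<Sum>j\<in>V. a i j * x j) \<ge> s ^ card V * (\<Prod>i\<in>V. x i)"
proof (cases "V = {}")
  case False
  define y where "y i = (\<Sum>j\<in>V. a i j * x j)" for i
  have y: "y i > 0" if "i \<in> V" for i
    unfolding y_def using that a x fin False by (intro sum_pos) auto
  have ln_y: "(\<Sum>j\<in>V. a i j * ln (x j)) / s \<le> ln (y i / s)" if i: "i \<in> V" for i
  proof -
    have "ln (x j) \<le> ln (y i / s) + (s * x j / y i - 1)" for j
    proof -
      have "ln (s * x j / y i) \<le> s * x j / y i - 1"
        using x[of j] y[OF i] s by (intro ln_le_minus_one) auto
      moreover have "ln (s * x j / y i) = ln (x j) - ln (y i / s)"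
        using x[of j] y[OF i] s by (simp add: ln_div ln_mult)
      ultimately show ?thesis by simp
    qed
    then have "(\<Sum>j\<in>V. a i j * ln (x j)) \<le> (\<Sum>j\<in>V. a i j * (ln (y i / s) + (s * x j / y i - 1)))"
      using i less_imp_le[OF a] by (intro sum_mono mult_left_mono) auto
    also have "\<dots> = (\<Sum>j\<in>V. a i j * (ln (y i / s) - 1) + s / y i * (a i j * x j))"
      by (intro sum.cong) (auto simp: algebra_simps)
    also have "\<dots> = (\<Sum>j\<in>V. a i j) * (ln (y i / s) - 1) + s / y i * y i"
      by (simp only: sum.distrib sum_distrib_left sum_distrib_right y_def)
    also have "\<dots> = s * ln (y i / s)" using y[OF i] row[OF i] by (simp add: algebra_simps)
    finally show ?thesis using s by (simp add: field_simps)
  qed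
  have "(\<Sum>j\<in>V. ln (x j)) = (\<Sum>j\<in>V. (\<Sum>i\<in>V. a i j) * ln (x j)) / s"
    using s col by (simp add: sum_divide_distrib)
  also have "\<dots> = (\<Sum>i\<in>V. (\<Sum>j\<in>V. a i j * ln (x j)) / s)"
    unfolding sum_distrib_right sum_divide_distrib[symmetric] by (subst sum.swap) simp
  also have "\<dots> \<le> (\<Sum>i\<in>V. ln (y i / s))" using ln_y by (intro sum_mono)
  finally have "exp (\<Sum>j\<in>V. ln (x j)) \<le> exp (\<Sum>i\<in>V. ln (y i / s))" by simp
  then have "(\<Prod>i\<in>V. x i) \<le> (\<Prod>i\<in>V. y i / s)" using x y s fin by (simp add: exp_sum)
  then show ?thesis using s by (simp add: prod_dividef y_def field_simps)
qed simp

lemma permanent_ge_positive: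
  fixes a :: "'v \<Rightarrow> 'v \<Rightarrow> real"
  assumes fin: "finite V" and a: "\<And>i j. i \<in> V \<Longrightarrow> j \<in> V \<Longrightarrow> a i j > 0"
    and row: "\<And>i. i \<in> V \<Longrightarrow> (\<Sum>j\<in>V. a i j) = s"
    and col: "\<And>j. j \<in> V \<Longrightarrow> (\<Sum>i\<in>V. a i j) = s"
    and s: "s > 0"
  shows "(\<Sum>\<sigma> | \<sigma> permutes V. \<Prod>i\<in>V. a i (\<sigma> i)) \<ge> (s / exp 1) ^ card V"
proof -
  have "mixed_part V a (V - V) (\<lambda>_. 1) \<ge> s ^ card V / exp 1 ^ card V * (\<Prod>i\<in>V - V. 1)"
    using mixed_part_capacity[OF fin a _ prod_row_sums_ge[OF fin a row col s], of V] s by auto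
  then show ?thesis using fin by (simp add: mixed_part_empty power_divide)
qed

text \<open>Strict stability needs positive entries, so a constant is added to every entry and sent
  to 0. The bound is slightly weaker than van der Waerden's.\<close>

theorem permanent_ge:
  fixes a :: "'v \<Rightarrow> 'v \<Rightarrow> real"
  assumes fin: "finite V" and a: "\<And>i j. i \<in> V \<Longrightarrow> j \<in> V \<Longrightarrow> a i j \<ge> 0"
    and row: "\<And>i. i \<in> V \<Longrightarrow> (\<Sum>j\<in>V. a i j) = s"
    and col: "\<And>j. j \<in> V \<Longrightarrow> (\<Sum>i\<in>V. a i j) = s"
    and s: "s \<ge> 0"
  shows "(\<Sum>\<sigma> | \<sigma> permutes V. \<Prod>i\<in>V. a i (\<sigma> i)) \<ge> (s / exp 1) ^ card V"
proof (cases "V = {}")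
  case False
  let ?f = "\<lambda>e::real. \<Sum>\<sigma> | \<sigma> permutes V. \<Prod>i\<in>V. (a i (\<sigma> i) + e)"
  let ?g = "\<lambda>e::real. ((s + card V * e) / exp 1) ^ card V"
  have "((\<lambda>e. a i j + e) \<longlongrightarrow> a i j + 0) (at_right 0)" for i j by (intro tendsto_intros)
  then have f: "(?f \<longlongrightarrow> ?f 0) (at_right 0)" by (intro tendsto_sum tendsto_prod) auto
  have g: "(?g \<longlongrightarrow> ((s + card V * 0) / exp 1) ^ card V) (at_right 0)"
    by (rule tendsto_eq_intros refl | simp)+
  have "?g e \<le> ?f e" if "e > 0" for e
    using that a s row col fin False
    by (intro permanent_ge_positive) (auto simp: sum.distrib add_nonneg_pos card_gt_0_iff)
  then have "\<forall>\<^sub>F e in at_right 0. ?g e \<le> ?f e"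
    by (auto simp: eventually_at_right_field intro: exI[of _ 1])
  from tendsto_le[OF _ f g this] show ?thesis by simp
qed simp

section \<open>Hadamard's inequality\<close>

definition herm :: "nat \<Rightarrow> (nat \<Rightarrow> complex) \<Rightarrow> (nat \<Rightarrow> complex) \<Rightarrow> complex" where
  "herm n u v = (\<Sum>k<n. u k * cnj (v k))"

lemma herm_self: "herm n u u = of_real (\<Sum>k<n. (norm (u k))\<^sup>2)"
  by (simp add: herm_def flip: complex_norm_square)

lemma herm_self_eq_0: "herm n u u = 0 \<Longrightarrow> k < n \<Longrightarrow> u k = 0"
  unfolding herm_self of_real_eq_0_iff by (subst (asm) sum_nonneg_eq_0_iff) auto

lemma herm_zero_left: "herm n u u = 0 \<Longrightarrow> herm n v u = 0"
  unfolding herm_def[of n v] using herm_self_eq_0[of n u] by (intro sum.neutral) auto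

lemma herm_cnj: "herm n v u = cnj (herm n u v)"
  by (simp add: herm_def mult.commute)

lemma herm_diff_left: "herm n (\<lambda>k. u k - v k) x = herm n u x - herm n v x"
  by (simp add: herm_def algebra_simps sum_subtractf)

lemma herm_add_left: "herm n (\<lambda>k. u k + v k) x = herm n u x + herm n v x"
  by (simp add: herm_def algebra_simps sum.distrib)

lemma herm_sum_left: "herm n (\<lambda>k. \<Sum>j<m. c j * b j k) x = (\<Sum>j<m. c j * herm n (b j) x)"
  unfolding herm_def sum_distrib_left sum_distrib_right
  by (subst sum.swap) (simp add: mult.assoc)

lemma det_subtract_rows:
  assumes "m < n" "l \<le> m"
  shows "det (mat n n (\<lambda>(i, k). if i = m then (B m k :: complex) - (\<Sum>j<l. c j * B j k) else B i k)) =
    det (mat n n (\<lambda>(i, k). B i k))"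
  using assms(2)
proof (induction l)
  case (Suc l)
  let ?B = "\<lambda>l. mat n n (\<lambda>(i, k). if i = m then B m k - (\<Sum>j<l. c j * B j k) else B i k)"
  have "?B (Suc l) = addrow (- c l) m l (?B l)"
    using Suc.prems assms(1) by (intro eq_matI) auto
  then show ?case using Suc assms(1) by (simp add: det_addrow[of l n])
qed (auto intro!: arg_cong[where f = det] eq_matI)

text \<open>Gram-Schmidt without normalisation: row \<open>m\<close> is replaced by its residual
  modulo the earlier rows. This leaves the determinant alone, and by Pythagoras it does not lengthen
  the row.\<close>

lemma gram_schmidt_rows:
  assumes "m \<le> n"
  shows "\<exists>B. det (mat n n (\<lambda>(i, k). B i k)) = det (mat n n (\<lambda>(i, k). A i k)) \<and>
    (\<forall>i<n. Re (herm n (B i) (B i)) \<le> Re (herm n (A i) (A i))) \<and>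
    (\<forall>i<m. \<forall>j<m. i \<noteq> j \<longrightarrow> herm n (B i) (B j) = 0) \<and> (\<forall>i\<ge>m. B i = A i)"
  using assms
proof (induction m)
  case 0
  show ?case by (intro exI[of _ A]) auto
next
  case (Suc m)
  then obtain B where B: "det (mat n n (\<lambda>(i, k). B i k)) = det (mat n n (\<lambda>(i, k). A i k))"
    "\<And>i. i < n \<Longrightarrow> Re (herm n (B i) (B i)) \<le> Re (herm n (A i) (A i))"
    "\<And>i j. i < m \<Longrightarrow> j < m \<Longrightarrow> i \<noteq> j \<Longrightarrow> herm n (B i) (B j) = 0" "\<And>i. i \<ge> m \<Longrightarrow> B i = A i"
    by auto
  define c where "c j = herm n (B m) (B j) / herm n (B j) (B j)" for j
  define p where "p k = (\<Sum>j<m. c j * B j k)" for k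
  define r where "r k = B m k - p k" for k
  \<comment> \<open>Zero rows need no separate treatment: there \<open>c j\<close> is a division by
    0, hence 0, and the right-hand side vanishes as well.\<close>
  have c: "c j * herm n (B j) (B j) = herm n (B m) (B j)" for j
    using herm_zero_left[of n "B j" "B m"] by (auto simp: c_def)
  have rj: "herm n r (B j) = 0" if j: "j < m" for j
  proof -
    have "herm n p (B j) = (\<Sum>i<m. c i * herm n (B i) (B j))"
      unfolding p_def by (rule herm_sum_left)
    also have "\<dots> = (\<Sum>i<m. if i = j then herm n (B m) (B j) else 0)"
      using j B(3) c by (intro sum.cong) auto
    also have "\<dots> = herm n (B m) (B j)" using j by simp
    finally show ?thesis unfolding r_def herm_diff_left by simp
  qed
  then have rj': "herm n (B j) r = 0" if "j < m" for j
    using that herm_cnj[of n "B j" r] by simp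
  then have "herm n p r = 0"
    unfolding p_def herm_sum_left by simp
  then have pr: "herm n p r = 0" "herm n r p = 0" using herm_cnj[of n r p] by auto
  have Bm: "B m = (\<lambda>k. r k + p k)" by (auto simp: r_def)
  have "herm n (B m) (B m) = herm n r r + herm n p p"
    unfolding Bm herm_add_left herm_cnj[of n _ "\<lambda>k. r k + p k"] by (simp add: pr flip: herm_cnj)
  moreover have "Re (herm n p p) \<ge> 0" unfolding herm_self by (simp add: sum_nonneg)
  ultimately have rle: "Re (herm n r r) \<le> Re (herm n (B m) (B m))" by simp
  have "det (mat n n (\<lambda>(i, k). (B(m := r)) i k)) = det (mat n n (\<lambda>(i, k). B i k))"
  proof -
    have "mat n n (\<lambda>(i, k). (B(m := r)) i k) =
        mat n n (\<lambda>(i, k). if i = m then B m k - (\<Sum>j<m. c j * B j k) else B i k)"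
      by (intro eq_matI) (auto simp: r_def p_def)
    then show ?thesis using det_subtract_rows[of m n m B c] Suc.prems by simp
  qed
  moreover have "herm n ((B(m := r)) i) ((B(m := r)) j) = 0" if "i < Suc m" "j < Suc m" "i \<noteq> j" for i j
    using that rj rj' B(3) by (auto simp: less_Suc_eq)
  moreover have "Re (herm n ((B(m := r)) i) ((B(m := r)) i)) \<le> Re (herm n (A i) (A i))" if "i < n" for i
    using B(2)[OF that] rle by (cases "i = m") auto
  ultimately show ?case using B by (intro exI[of _ "B(m := r)"]) auto
qed

text \<open>For orthogonal rows, the product of the matrix with its conjugate transpose is diagonal
  with the squared row lengths as entries, so equality holds for the rows produced by
  Gram-Schmidt.\<close>

theorem hadamard_mat:
  fixes A :: "nat \<Rightarrow> nat \<Rightarrow> complex"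
  shows "(norm (det (mat n n (\<lambda>(i, k). A i k))))\<^sup>2 \<le> (\<Prod>i<n. \<Sum>k<n. (norm (A i k))\<^sup>2)"
proof -
  obtain B where B: "det (mat n n (\<lambda>(i, k). B i k)) = det (mat n n (\<lambda>(i, k). A i k))"
    "\<And>i. i < n \<Longrightarrow> Re (herm n (B i) (B i)) \<le> Re (herm n (A i) (A i))"
    "\<And>i j. i < n \<Longrightarrow> j < n \<Longrightarrow> i \<noteq> j \<Longrightarrow> herm n (B i) (B j) = 0"
    using gram_schmidt_rows[of n n A] by auto
  define M where "M = mat n n (\<lambda>(i, k). B i k)"
  define H where "H = mat n n (\<lambda>(i, k). cnj (B k i))"
  have M: "M \<in> carrier_mat n n" and H: "H \<in> carrier_mat n n" by (auto simp: M_def H_def)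
  interpret cnj: comm_ring_hom cnj by unfold_locales auto
  have "H = transpose_mat (map_mat cnj M)" by (intro eq_matI) (auto simp: H_def M_def)
  then have "det H = cnj (det M)"
    using det_transpose[of "map_mat cnj M" n] M by (simp add: cnj.hom_det)
  then have "of_real ((norm (det M))\<^sup>2) = det (M * H)"
    using det_mult[OF M H] unfolding complex_norm_square by simp
  also have MH: "M * H = mat n n (\<lambda>(i, j). herm n (B i) (B j))"
    by (intro eq_matI) (auto simp: M_def H_def scalar_prod_def herm_def atLeast0LessThan)
  also have "det \<dots> = prod_list (diag_mat \<dots>)"
    using B(3) by (intro det_upper_triangular) auto
  also have "\<dots> = (\<Prod>i<n. herm n (B i) (B i))"
    by (auto simp: prod_list_diag_prod atLeast0LessThan)
  also have "\<dots> = of_real (\<Prod>i<n. \<Sum>k<n. (norm (B i k))\<^sup>2)" unfolding herm_self by simp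
  finally have "(norm (det M))\<^sup>2 = (\<Prod>i<n. \<Sum>k<n. (norm (B i k))\<^sup>2)"
    unfolding of_real_eq_iff .
  also have "\<dots> \<le> (\<Prod>i<n. \<Sum>k<n. (norm (A i k))\<^sup>2)"
    using B(2) by (intro prod_mono) (auto simp: herm_self sum_nonneg)
  finally show ?thesis unfolding M_def B(1) .
qed

text \<open>The index set is an argument, so a principal minor of \<open>M\<close> is just
  \<open>set_det T M\<close> for a smaller set \<open>T\<close>.\<close>

definition set_det :: "'s set \<Rightarrow> ('s \<Rightarrow> 's \<Rightarrow> 'a::comm_ring_1) \<Rightarrow> 'a" where
  "set_det S M = (\<Sum>\<sigma> | \<sigma> permutes S. of_int (sign \<sigma>) * (\<Prod>s\<in>S. M s (\<sigma> s)))"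

lemma set_det_reindex:
  assumes h: "bij_betw h A B" and fin: "finite A"
  shows "set_det B M = set_det A (\<lambda>i j. M (h i) (h j))"
  unfolding set_det_def
proof (rule sum.reindex_bij_witness[of _ "map_permutation B (inv_into A h)" "map_permutation A h", symmetric])
  have inj: "inj_on h A" and hA: "h ` A = B" using h by (auto simp: bij_betw_def)
  fix \<sigma> assume "\<sigma> \<in> {\<sigma>. \<sigma> permutes B}"
  then have \<sigma>: "\<sigma> permutes B" by simp
  show "map_permutation B (inv_into A h) \<sigma> \<in> {\<sigma>. \<sigma> permutes A}"
    using map_permutation_permutes[OF bij_betw_inv_into[OF h] \<sigma>] by simp
  show "map_permutation A h (map_permutation B (inv_into A h) \<sigma>) = \<sigma>"
    using h by (intro map_permutation_compose_inv[OF bij_betw_inv_into[OF h] \<sigma>]) (auto simp: bij_betw_inv_into_right)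
next
  have inj: "inj_on h A" and hA: "h ` A = B" using h by (auto simp: bij_betw_def)
  fix \<sigma> assume "\<sigma> \<in> {\<sigma>. \<sigma> permutes A}"
  then have \<sigma>: "\<sigma> permutes A" by simp
  show "map_permutation A h \<sigma> \<in> {\<sigma>. \<sigma> permutes B}"
    using map_permutation_permutes[OF h \<sigma>] by simp
  show "map_permutation B (inv_into A h) (map_permutation A h \<sigma>) = \<sigma>"
    using h by (intro map_permutation_compose_inv[OF h \<sigma>]) (auto simp: bij_betw_inv_into_left)
  have "(\<Prod>s\<in>B. M s (map_permutation A h \<sigma> s)) = (\<Prod>s\<in>A. M (h s) (map_permutation A h \<sigma> (h s)))"
    by (rule prod.reindex_bij_betw[OF h, symmetric])
  also have "\<dots> = (\<Prod>s\<in>A. M (h s) (h (\<sigma> s)))"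
    by (intro prod.cong refl) (simp add: map_permutation_apply[OF inj])
  finally show "of_int (sign (map_permutation A h \<sigma>)) * (\<Prod>s\<in>B. M s (map_permutation A h \<sigma> s)) =
      of_int (sign \<sigma>) * (\<Prod>s\<in>A. M (h s) (h (\<sigma> s)))"
    by (simp add: sign_map_permutation[OF inj \<sigma> fin])
qed

theorem hadamard:
  fixes M :: "'s \<Rightarrow> 's \<Rightarrow> complex"
  assumes "finite S"
  shows "(norm (set_det S M))\<^sup>2 \<le> (\<Prod>s\<in>S. \<Sum>t\<in>S. (norm (M s t))\<^sup>2)"
proof -
  obtain h where h: "bij_betw h {0..<card S} S" using ex_bij_betw_nat_finite[OF assms] by auto
  have "set_det S M = set_det {0..<card S} (\<lambda>i j. M (h i) (h j))"
    using set_det_reindex[OF h] by simp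
  also have "\<dots> = det (mat (card S) (card S) (\<lambda>(i, k). M (h i) (h k)))"
    unfolding set_det_def by (subst det_def'[of _ "card S"])
      (auto intro!: sum.cong prod.cong arg_cong2[where f = "(*)"] simp: permutes_in_image)
  finally have "(norm (set_det S M))\<^sup>2 \<le> (\<Prod>i<card S. \<Sum>k<card S. (norm (M (h i) (h k)))\<^sup>2)"
    using hadamard_mat by simp
  also have "\<dots> = (\<Prod>i<card S. \<Sum>t\<in>S. (norm (M (h i) t))\<^sup>2)"
    using h by (intro prod.cong refl sum.reindex_bij_betw) (simp add: atLeast0LessThan)
  also have "\<dots> = (\<Prod>s\<in>S. \<Sum>t\<in>S. (norm (M s t))\<^sup>2)"
    using h by (intro prod.reindex_bij_betw) (simp add: atLeast0LessThan)
  finally show ?thesis .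
qed

section \<open>Sums of transversal minors\<close>

text \<open>Multiply out the product in each term of the determinant. Choosing the identity entry
  outside \<open>T\<close> forces the permutation to fix everything there, so that it is a
  permutation of \<open>T\<close>.\<close>

lemma set_det_identity_plus:
  fixes M :: "'s \<Rightarrow> 's \<Rightarrow> 'a::comm_ring_1"
  assumes fin: "finite S"
  shows "set_det S (\<lambda>s t. M s t + of_bool (s = t)) = (\<Sum>T\<in>Pow S. set_det T M)"
proof -
  let ?P = "{\<sigma>. \<sigma> permutes S}"
  have "set_det S (\<lambda>s t. M s t + of_bool (s = t)) =
    (\<Sum>\<sigma>\<in>?P. \<Sum>T\<in>Pow S. of_int (sign \<sigma>) * ((\<Prod>s\<in>T. M s (\<sigma> s)) * (\<Prod>s\<in>S - T. of_bool (s = \<sigma> s))))"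
    unfolding set_det_def by (simp add: prod_add[OF fin] sum_distrib_left)
  also have "\<dots> = (\<Sum>T\<in>Pow S. \<Sum>\<sigma>\<in>?P. of_int (sign \<sigma>) * ((\<Prod>s\<in>T. M s (\<sigma> s)) * (\<Prod>s\<in>S - T. of_bool (s = \<sigma> s))))"
    by (rule sum.swap)
  also have "\<dots> = (\<Sum>T\<in>Pow S. set_det T M)"
    unfolding set_det_def
  proof (rule sum.cong[OF refl], rule sum.mono_neutral_cong_right)
    show "finite ?P" using fin by (rule finite_permutations)
  next
    fix T assume T: "T \<in> Pow S"
    show "{\<sigma>. \<sigma> permutes T} \<subseteq> ?P" using T permutes_subset by auto
    show "\<forall>\<sigma>\<in>?P - {\<sigma>. \<sigma> permutes T}.
      of_int (sign \<sigma>) * ((\<Prod>s\<in>T. M s (\<sigma> s)) * (\<Prod>s\<in>S - T. of_bool (s = \<sigma> s))) = 0"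
    proof
      fix \<sigma> assume "\<sigma> \<in> ?P - {\<sigma>. \<sigma> permutes T}"
      then have \<sigma>: "\<sigma> permutes S" "\<not> \<sigma> permutes T" by auto
      then have "\<exists>s\<in>S - T. s \<noteq> \<sigma> s" using permutes_superset[OF \<sigma>(1), of T] by metis
      then have "(\<Prod>s\<in>S - T. of_bool (s = \<sigma> s)) = (0::'a)"
        using fin by (intro prod_zero) auto
      then show "of_int (sign \<sigma>) * ((\<Prod>s\<in>T. M s (\<sigma> s)) * (\<Prod>s\<in>S - T. of_bool (s = \<sigma> s))) = 0"
        by simp
    qed
    fix \<sigma> assume "\<sigma> \<in> {\<sigma>. \<sigma> permutes T}"
    then have "\<sigma> s = s" if "s \<in> S - T" for s using that permutes_not_in by auto
    then have "(\<Prod>s\<in>S - T. of_bool (s = \<sigma> s)) = (1::'a)" by (intro prod.neutral) auto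
    then show "of_int (sign \<sigma>) * ((\<Prod>s\<in>T. M s (\<sigma> s)) * (\<Prod>s\<in>S - T. of_bool (s = \<sigma> s))) =
      of_int (sign \<sigma>) * (\<Prod>s\<in>T. M s (\<sigma> s))" by simp
  qed
  finally show ?thesis .
qed

lemma set_det_scale_rows:
  "set_det T (\<lambda>s t. x s * M s t) = (\<Prod>s\<in>T. x s) * set_det T M"
  by (simp add: set_det_def prod.distrib sum_distrib_left mult_ac)

lemma sum_roots_of_unity:
  assumes "q > 0"
  shows "(\<Sum>a<q. cis (2 * pi / q) ^ (a * m)) = (if q dvd m then of_nat q else 0)"
proof -
  let ?z = "cis (2 * pi / q)"
  have zk: "?z ^ k = cis (2 * pi * k / q)" for k by (simp add: DeMoivre mult_ac)
  have zq: "?z ^ q = 1" using assms by (simp add: zk)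
  have "?z ^ m = (?z ^ q) ^ (m div q) * ?z ^ (m mod q)" by (simp flip: power_mult power_add)
  then have zm: "?z ^ m = ?z ^ (m mod q)" by (simp add: zq)
  have pow: "?z ^ (a * m) = (?z ^ m) ^ a" for a by (simp add: mult.commute flip: power_mult)
  show ?thesis
  proof (cases "q dvd m")
    case True
    then have "?z ^ m = 1" by (simp add: zm)
    then show ?thesis using True by (simp add: pow)
  next
    case False
    have "?z ^ m \<noteq> 1"
    proof
      assume "?z ^ m = 1"
      then have "cis (2 * pi * real (m mod q) / q) = cis (2 * pi * real 0 / q)"
        using zm zk[of "m mod q"] by simp
      then have "m mod q = 0"
        using bij_betw_imp_inj_on[OF bij_betw_roots_unity[OF assms]] assms
        by (auto dest!: inj_onD[where x = "m mod q" and y = 0])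
      with False show False by auto
    qed
    moreover have "(?z ^ m) ^ q = 1" by (metis zq mult.commute power_mult power_one)
    ultimately show ?thesis using False by (simp add: pow geometric_sum)
  qed
qed

lemma sum_transversals:
  assumes "finite V" "finite I"
  shows "(\<Sum>T | T \<in> Pow (V \<times> I) \<and> (\<forall>v\<in>V. card {i \<in> I. (v, i) \<in> T} = 1). f T) =
    (\<Sum>c\<in>V \<rightarrow>\<^sub>E I. f ((\<lambda>v. (v, c v)) ` V))"
proof (rule sum.reindex_bij_witness[of _ "\<lambda>c. (\<lambda>v. (v, c v)) ` V"
      "\<lambda>T. \<lambda>v\<in>V. THE i. i \<in> I \<and> (v, i) \<in> T"])
  fix T assume T: "T \<in> {T. T \<in> Pow (V \<times> I) \<and> (\<forall>v\<in>V. card {i \<in> I. (v, i) \<in> T} = 1)}"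
  let ?c = "\<lambda>v\<in>V. THE i. i \<in> I \<and> (v, i) \<in> T"
  have ex1: "\<exists>!i. i \<in> I \<and> (v, i) \<in> T" if "v \<in> V" for v
  proof -
    have "card {i \<in> I. (v, i) \<in> T} = 1" using T that by auto
    then obtain i where "{i \<in> I. (v, i) \<in> T} = {i}" by (rule card_1_singletonE)
    then show ?thesis by (metis (mono_tags, lifting) mem_Collect_eq singleton_iff)
  qed
  have c: "?c v \<in> I \<and> (v, ?c v) \<in> T" if "v \<in> V" for v
    using theI'[OF ex1[OF that]] that by simp
  then show "?c \<in> V \<rightarrow>\<^sub>E I" by auto
  show eq: "(\<lambda>v. (v, ?c v)) ` V = T"
  proof
    show "(\<lambda>v. (v, ?c v)) ` V \<subseteq> T" using c by blast
    show "T \<subseteq> (\<lambda>v. (v, ?c v)) ` V"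
    proof
      fix s assume s: "s \<in> T"
      then obtain v i where vi: "s = (v, i)" "v \<in> V" "i \<in> I" using T by auto
      then have "?c v = i" using ex1[of v] c[of v] s by blast
      then show "s \<in> (\<lambda>v. (v, ?c v)) ` V" using vi by (intro image_eqI[of _ _ v]) auto
    qed
  qed
  show "f ((\<lambda>v. (v, ?c v)) ` V) = f T" unfolding eq ..
next
  fix c assume c: "c \<in> V \<rightarrow>\<^sub>E I"
  then have "{i \<in> I. (v, i) \<in> (\<lambda>v. (v, c v)) ` V} = {c v}" if "v \<in> V" for v using that by auto
  then show "(\<lambda>v. (v, c v)) ` V \<in> {T. T \<in> Pow (V \<times> I) \<and> (\<forall>v\<in>V. card {i \<in> I. (v, i) \<in> T} = 1)}"
    using c by auto
  show "(\<lambda>v\<in>V. THE i. i \<in> I \<and> (v, i) \<in> (\<lambda>v. (v, c v)) ` V) = c"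
    using c by (intro extensionalityI[of _ V]) (auto simp: PiE_iff intro!: the_equality)
qed

text \<open>Give all rows of block \<open>v\<close> the weight
  \<open>r * \<zeta> ^ \<theta> v\<close> and expand the determinant of identity plus weighted
  \<open>M\<close> into principal minors. Fourier averaging over \<open>\<theta>\<close> extracts
  the minors that meet every block exactly once, and Hadamard's inequality bounds each determinant
  in the average.\<close>

theorem transversal_minors_bound:
  fixes M :: "'v \<times> 'i \<Rightarrow> 'v \<times> 'i \<Rightarrow> complex" and r R :: real
  assumes V: "finite V" and I: "finite I" "I \<noteq> {}" and r: "r > 0"
    and diag: "\<And>s. s \<in> V \<times> I \<Longrightarrow> M s s = 0"
    and row: "\<And>s. s \<in> V \<times> I \<Longrightarrow> (\<Sum>t\<in>V \<times> I. (norm (M s t))\<^sup>2) \<le> R"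
  shows "(r ^ card V * norm (\<Sum>c\<in>V \<rightarrow>\<^sub>E I. set_det V (\<lambda>u v. M (u, c u) (v, c v))))\<^sup>2
    \<le> (1 + r\<^sup>2 * R) ^ (card V * card I)"
proof -
  define N where "N = card I"
  \<comment> \<open>A set contains between 0 and \<open>N\<close> rows of a block. Modulo
    \<open>N + 1\<close> these counts are distinct and \<open>N\<close> is \<open>- 1\<close>, so
    the twist \<open>\<zeta> ^ (\<theta> v * N)\<close> selects the count 1.\<close>
  define q where "q = Suc N"
  define \<zeta> where "\<zeta> = cis (2 * pi / real q)"
  define \<Theta> where "\<Theta> = V \<rightarrow>\<^sub>E {..<q}"
  define x where "x \<theta> s = of_real r * \<zeta> ^ \<theta> (fst s)" for \<theta> :: "'v \<Rightarrow> nat" and s :: "'v \<times> 'i"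
  define B where "B = sqrt ((1 + r\<^sup>2 * R) ^ (card V * N))"
  define D where "D \<theta> = set_det (V \<times> I) (\<lambda>s t. x \<theta> s * M s t + of_bool (s = t))" for \<theta>
  define transv where "transv T \<longleftrightarrow> (\<forall>v\<in>V. card {i \<in> I. (v, i) \<in> T} = 1)" for T :: "('v \<times> 'i) set"
  have N: "N > 0" using I by (auto simp: N_def card_gt_0_iff)
  have fin: "finite (V \<times> I)" "finite \<Theta>" using V I by (auto simp: \<Theta>_def finite_PiE)
  have nz: "norm \<zeta> = 1" by (simp add: \<zeta>_def)
  have D_le: "norm (D \<theta>) \<le> B" for \<theta>
  proof -
    have "(\<Sum>t\<in>V \<times> I. (norm (x \<theta> s * M s t + of_bool (s = t)))\<^sup>2) \<le> 1 + r\<^sup>2 * R" if s: "s \<in> V \<times> I" for s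
    proof -
      \<comment> \<open>The diagonal of \<open>M\<close> vanishes, so the identity and the weighted
        row never meet in one entry and there is no cross term.\<close>
      have "(\<Sum>t\<in>V \<times> I. (norm (x \<theta> s * M s t + of_bool (s = t)))\<^sup>2) =
          (\<Sum>t\<in>V \<times> I. of_bool (s = t) + r\<^sup>2 * (norm (M s t))\<^sup>2)"
        using diag[OF s] by (intro sum.cong) (auto simp: x_def norm_mult norm_power nz power_mult_distrib)
      also have "\<dots> = 1 + r\<^sup>2 * (\<Sum>t\<in>V \<times> I. (norm (M s t))\<^sup>2)"
        using s fin by (simp add: sum.distrib sum_distrib_left of_bool_def)
      also have "\<dots> \<le> 1 + r\<^sup>2 * R" using row[OF s] by (intro add_left_mono mult_left_mono) auto
      finally show ?thesis .
    qed
    then have "(\<Prod>s\<in>V \<times> I. \<Sum>t\<in>V \<times> I. (norm (x \<theta> s * M s t + of_bool (s = t)))\<^sup>2) \<le> (\<Prod>s\<in>V \<times> I. 1 + r\<^sup>2 * R)"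
      by (intro prod_mono) (auto intro: sum_nonneg)
    with hadamard[OF fin(1)] have "(norm (D \<theta>))\<^sup>2 \<le> (1 + r\<^sup>2 * R) ^ (card V * N)"
      unfolding D_def by (simp add: N_def card_cartesian_product) (meson order_trans)
    then show ?thesis unfolding B_def by (rule real_le_rsqrt)
  qed
  have phase: "(\<Sum>\<theta>\<in>\<Theta>. (\<Prod>v\<in>V. \<zeta> ^ (\<theta> v * N)) * (\<Prod>s\<in>T. x \<theta> s)) =
      (if transv T then (of_nat q * of_real r) ^ card V else 0)" if T: "T \<in> Pow (V \<times> I)" for T
  proof -
    define t where "t v = card {i \<in> I. (v, i) \<in> T}" for v
    have "T = Sigma V (\<lambda>v. {i \<in> I. (v, i) \<in> T})" using T by auto
    then have "(\<Prod>s\<in>T. x \<theta> s) = (\<Prod>s\<in>Sigma V (\<lambda>v. {i \<in> I. (v, i) \<in> T}). x \<theta> s)" for \<theta> by simp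
    also have "\<dots> \<theta> = (\<Prod>v\<in>V. \<Prod>i | i \<in> I \<and> (v, i) \<in> T. x \<theta> (v, i))" for \<theta>
      using V I by (subst prod.Sigma) auto
    also have "\<dots> \<theta> = (\<Prod>v\<in>V. of_real r ^ t v * \<zeta> ^ (\<theta> v * t v))" for \<theta>
      by (simp add: x_def t_def power_mult_distrib power_mult)
    finally have prod_x: "(\<Prod>s\<in>T. x \<theta> s) = (\<Prod>v\<in>V. of_real r ^ t v * \<zeta> ^ (\<theta> v * t v))" for \<theta> .
    have "(\<Sum>\<theta>\<in>\<Theta>. (\<Prod>v\<in>V. \<zeta> ^ (\<theta> v * N)) * (\<Prod>s\<in>T. x \<theta> s)) =
        (\<Sum>\<theta>\<in>\<Theta>. \<Prod>v\<in>V. of_real r ^ t v * \<zeta> ^ (\<theta> v * (N + t v)))"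
      unfolding prod_x by (intro sum.cong refl) (simp add: distrib_left power_add mult_ac flip: prod.distrib)
    also have "\<dots> = (\<Prod>v\<in>V. \<Sum>a<q. of_real r ^ t v * \<zeta> ^ (a * (N + t v)))"
      unfolding \<Theta>_def using V by (subst prod_sum_PiE) auto
    also have "\<dots> = (\<Prod>v\<in>V. if t v = 1 then of_nat q * of_real r else 0)"
    proof (rule prod.cong[OF refl])
      fix v
      have "t v \<le> N" unfolding t_def N_def using I by (intro card_mono) auto
      have "q dvd N + t v \<longleftrightarrow> t v = 1"
      proof
        assume "q dvd N + t v"
        then obtain m where m: "N + t v = q * m" by auto
        have "m \<noteq> 0" using m N by (cases m) auto
        moreover have "m < 2"
        proof (rule ccontr)
          assume "\<not> m < 2"
          then have "q * 2 \<le> q * m" by (intro mult_left_mono) auto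
          then show False using m \<open>t v \<le> N\<close> by (simp add: q_def)
        qed
        ultimately have "m = 1" by simp
        then show "t v = 1" using m by (simp add: q_def)
      qed (simp add: q_def)
      then show "(\<Sum>a<q. of_real r ^ t v * \<zeta> ^ (a * (N + t v))) = (if t v = 1 then of_nat q * of_real r else 0)"
        using sum_roots_of_unity[of q "N + t v"]
        unfolding sum_distrib_left[symmetric] \<zeta>_def by (simp add: q_def)
    qed
    also have "\<dots> = (if transv T then (of_nat q * of_real r) ^ card V else 0)"
      using V by (auto simp: transv_def t_def intro: prod_zero)
    finally show ?thesis .
  qed
  have "(\<Sum>\<theta>\<in>\<Theta>. (\<Prod>v\<in>V. \<zeta> ^ (\<theta> v * N)) * D \<theta>) =
      (\<Sum>\<theta>\<in>\<Theta>. \<Sum>T\<in>Pow (V \<times> I). (\<Prod>v\<in>V. \<zeta> ^ (\<theta> v * N)) * (\<Prod>s\<in>T. x \<theta> s) * set_det T M)"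
    unfolding D_def set_det_identity_plus[OF fin(1)] set_det_scale_rows
    by (simp add: sum_distrib_left mult.assoc)
  also have "\<dots> = (\<Sum>T\<in>Pow (V \<times> I). (\<Sum>\<theta>\<in>\<Theta>. (\<Prod>v\<in>V. \<zeta> ^ (\<theta> v * N)) * (\<Prod>s\<in>T. x \<theta> s)) * set_det T M)"
    by (subst sum.swap) (simp add: sum_distrib_right)
  also have "\<dots> = (\<Sum>T\<in>Pow (V \<times> I). if transv T then (of_nat q * of_real r) ^ card V * set_det T M else 0)"
    by (intro sum.cong refl) (simp add: phase)
  also have "\<dots> = (\<Sum>T | T \<in> Pow (V \<times> I) \<and> transv T. (of_nat q * of_real r) ^ card V * set_det T M)"
    using fin by (subst sum.inter_filter) auto
  also have "\<dots> = (of_nat q * of_real r) ^ card V * (\<Sum>c\<in>V \<rightarrow>\<^sub>E I. set_det ((\<lambda>v. (v, c v)) ` V) M)"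
    unfolding transv_def sum_transversals[OF V I(1)] sum_distrib_left ..
  also have "(\<Sum>c\<in>V \<rightarrow>\<^sub>E I. set_det ((\<lambda>v. (v, c v)) ` V) M) =
      (\<Sum>c\<in>V \<rightarrow>\<^sub>E I. set_det V (\<lambda>u v. M (u, c u) (v, c v)))"
    using V by (intro sum.cong refl set_det_reindex) (auto simp: bij_betw_def inj_on_def)
  finally have eq: "(of_nat q * of_real r) ^ card V * (\<Sum>c\<in>V \<rightarrow>\<^sub>E I. set_det V (\<lambda>u v. M (u, c u) (v, c v))) =
      (\<Sum>\<theta>\<in>\<Theta>. (\<Prod>v\<in>V. \<zeta> ^ (\<theta> v * N)) * D \<theta>)" (is "_ * ?X = _") ..
  have "real q ^ card V * (r ^ card V * norm ?X) = norm ((of_nat q * of_real r) ^ card V * ?X)"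
    using r by (simp add: norm_mult norm_power power_mult_distrib mult_ac)
  also have "\<dots> \<le> (\<Sum>\<theta>\<in>\<Theta>. norm ((\<Prod>v\<in>V. \<zeta> ^ (\<theta> v * N)) * D \<theta>))"
    unfolding eq by (rule norm_sum)
  also have "\<dots> \<le> (\<Sum>\<theta>\<in>\<Theta>. B)"
    using D_le by (intro sum_mono) (simp add: norm_mult norm_power nz flip: prod_norm)
  also have "\<dots> = real q ^ card V * B" using V by (simp add: \<Theta>_def card_PiE)
  finally have "r ^ card V * norm ?X \<le> B" by (simp add: q_def)
  then have "(r ^ card V * norm ?X)\<^sup>2 \<le> B\<^sup>2" using r by (intro power_mono) auto
  also have "B\<^sup>2 = (1 + r\<^sup>2 * R) ^ (card V * N)"
  proof (cases "V = {}")
    \<comment> \<open>The row bounds force \<open>R\<close> to be nonnegative only when there is a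
      row; otherwise the exponent is 0.\<close>
    case False
    then obtain s where "s \<in> V \<times> I" using I by auto
    from row[OF this] have "R \<ge> 0" by (rule order_trans[rotated]) (auto intro: sum_nonneg)
    then show ?thesis unfolding B_def by simp
  qed (simp add: B_def)
  finally show ?thesis unfolding N_def .
qed

section \<open>Cycles and traces\<close>

definition cycle_arcs :: "'v list \<Rightarrow> ('v \<times> 'v) list" where
  "cycle_arcs cs = zip cs (rotate1 cs)"

text \<open>Fixed points occur as lists of length 1, so the lists partition \<open>V\<close>. Empty
  lists, which \<open>cycle_decomp\<close> may produce, are excluded: each would put a spurious
  factor \<open>- 1\<close> into the sign formula.\<close>

definition cycle_lists :: "'v set \<Rightarrow> ('v \<Rightarrow> 'v) \<Rightarrow> 'v list list \<Rightarrow> bool" where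
  "cycle_lists V \<sigma> css \<longleftrightarrow> distinct (concat css) \<and> [] \<notin> set css \<and> set (concat css) = V \<and>
     (\<forall>cs\<in>set css. map \<sigma> cs = rotate1 cs)"

lemma sign_cycle_of_list:
  assumes "distinct cs" "cs \<noteq> []"
  shows "sign (cycle_of_list cs) = (- 1) ^ (length cs + 1)"
  using assms
  by (induction cs rule: cycle_of_list.induct)
    (auto simp: sign_compose permutation_swap_id permutation_of_cycle sign_swap_id)

lemma cycle_decomp_cycle_lists:
  assumes "cycle_decomp V \<sigma>"
  shows "\<sigma> permutes V \<and> finite V \<and> (\<exists>css. cycle_lists V \<sigma> css \<and>
    sign \<sigma> = (\<Prod>cs\<leftarrow>css. (- 1) ^ (length cs + 1)))"
  using assms
proof (induction)
  case empty
  show ?case by (auto intro!: exI[of _ "[]"] simp: cycle_lists_def permutes_empty)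
next
  case (comp I p cs)
  then obtain css where p: "p permutes I" "finite I" and css: "cycle_lists I p css"
    "sign p = (\<Prod>cs\<leftarrow>css. (- 1) ^ (length cs + 1))" by auto
  let ?q = "cycle_of_list cs \<circ> p"
  have perm: "permutation p" "permutation (cycle_of_list cs)"
    using p permutation_permutes permutation_of_cycle by auto
  have q: "?q permutes set cs \<union> I"
    using permutes_subset[OF p(1)] permutes_subset[OF cycle_permutes[of cs]]
    by (intro permutes_compose) auto
  show ?case
  proof (cases "cs = []")
    case True
    then show ?thesis using p css q by auto
  next
    case False
    have "p u = u" if "u \<in> set cs" for u
      using that comp.hyps(3) permutes_not_in[OF p(1)] by auto
    then have "map ?q cs = map (cycle_of_list cs) cs" by simp
    also have "\<dots> = rotate1 cs" using cyclic_rotation[OF comp.hyps(2), of 1] by simp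
    finally have new: "map ?q cs = rotate1 cs" .
    have "map ?q cs' = rotate1 cs'" if cs': "cs' \<in> set css" for cs'
    proof -
      have sub: "set cs' \<subseteq> I" using css(1) cs' by (auto simp: cycle_lists_def)
      have "?q u = p u" if "u \<in> set cs'" for u
      proof -
        have "p u \<in> I" using sub that permutes_in_image[OF p(1)] by auto
        then show ?thesis using comp.hyps(3) id_outside_supp[of "p u" cs] by auto
      qed
      then have "map ?q cs' = map p cs'" by simp
      also have "\<dots> = rotate1 cs'" using css(1) cs' by (simp add: cycle_lists_def)
      finally show ?thesis .
    qed
    then have "cycle_lists (set cs \<union> I) ?q (cs # css)"
      using css(1) new False comp.hyps(2,3) by (auto simp: cycle_lists_def)
    moreover have "sign ?q = (\<Prod>cs\<leftarrow>cs # css. (- 1) ^ (length cs + 1))"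
      by (simp add: sign_compose perm css(2) sign_cycle_of_list[OF comp.hyps(2) False])
    ultimately show ?thesis using q p by blast
  qed
qed

lemma permutation_cycle_lists:
  assumes "\<sigma> permutes V" "finite V"
  obtains css where "cycle_lists V \<sigma> css" "sign \<sigma> = (\<Prod>cs\<leftarrow>css. (- 1) ^ (length cs + 1))"
  using cycle_decomp_cycle_lists[OF cycle_decomposition[OF assms]] by auto

section \<open>Sums over labellings of the vertices as traces\<close>

lemma sum_PiE_insert:
  assumes "v \<notin> B"
  shows "(\<Sum>c\<in>insert v B \<rightarrow>\<^sub>E I. f c) = (\<Sum>a\<in>I. \<Sum>c\<in>B \<rightarrow>\<^sub>E I. f (c(v := a)))"
  unfolding PiE_insert_eq
  by (subst sum.reindex[OF inj_combinator[OF assms]]) (simp add: sum.cartesian_product split_def)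

lemma sum_PiE_Un:
  fixes F G :: "('v \<Rightarrow> 'i) \<Rightarrow> 'a::comm_semiring_1"
  assumes "A \<inter> B = {}"
    and F: "\<And>c c'. (\<And>a. a \<in> A \<Longrightarrow> c a = c' a) \<Longrightarrow> F c = F c'"
    and G: "\<And>c c'. (\<And>b. b \<in> B \<Longrightarrow> c b = c' b) \<Longrightarrow> G c = G c'"
  shows "(\<Sum>c\<in>A \<union> B \<rightarrow>\<^sub>E I. F c * G c) = (\<Sum>c\<in>A \<rightarrow>\<^sub>E I. F c) * (\<Sum>c\<in>B \<rightarrow>\<^sub>E I. G c)"
  unfolding sum_product sum.cartesian_product
proof (rule sum.reindex_bij_witness[of _ "\<lambda>(c1, c2) v. if v \<in> A then c1 v else c2 v"
      "\<lambda>c. (restrict c A, restrict c B)"])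
  fix c assume c: "c \<in> A \<union> B \<rightarrow>\<^sub>E I"
  then show "(restrict c A, restrict c B) \<in> (A \<rightarrow>\<^sub>E I) \<times> (B \<rightarrow>\<^sub>E I)" by auto
  show "(case (restrict c A, restrict c B) of (c1, c2) \<Rightarrow> \<lambda>v. if v \<in> A then c1 v else c2 v) = c"
    using c by (auto simp: fun_eq_iff PiE_iff extensional_def)
  show "(case (restrict c A, restrict c B) of (c1, c2) \<Rightarrow> F c1 * G c2) = F c * G c"
    using F[of "restrict c A" c] G[of "restrict c B" c] by simp
next
  fix p assume p: "p \<in> (A \<rightarrow>\<^sub>E I) \<times> (B \<rightarrow>\<^sub>E I)"
  then obtain c1 c2 where p_eq: "p = (c1, c2)" and c: "c1 \<in> A \<rightarrow>\<^sub>E I" "c2 \<in> B \<rightarrow>\<^sub>E I" by auto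
  show "(case p of (c1, c2) \<Rightarrow> \<lambda>v. if v \<in> A then c1 v else c2 v) \<in> A \<union> B \<rightarrow>\<^sub>E I"
    using c assms(1) by (auto simp: p_eq PiE_iff extensional_def)
  show "(restrict (case p of (c1, c2) \<Rightarrow> \<lambda>v. if v \<in> A then c1 v else c2 v) A,
      restrict (case p of (c1, c2) \<Rightarrow> \<lambda>v. if v \<in> A then c1 v else c2 v) B) = p"
    using c assms(1) by (auto simp: p_eq fun_eq_iff PiE_iff extensional_def)
qed

text \<open>The entry at \<open>(i, j)\<close> of the product of the matrices \<open>g e\<close>
  along the list.\<close>

primrec path_weight :: "'i set \<Rightarrow> ('e \<Rightarrow> 'i \<Rightarrow> 'i \<Rightarrow> 'a::comm_ring_1) \<Rightarrow> 'e list \<Rightarrow> 'i \<Rightarrow> 'i \<Rightarrow> 'a" where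
  "path_weight I g [] i j = of_bool (i = j)"
| "path_weight I g (e # es) i j = (\<Sum>l\<in>I. g e i l * path_weight I g es l j)"

text \<open>Summing over the labels of the inner vertices multiplies the matrices. Tails and heads
  are looked up by different tests because \<open>u\<close> and \<open>y\<close> may be the same
  vertex, carrying \<open>i\<close> at the start and \<open>j\<close> at the end.\<close>

lemma sum_path_weight:
  fixes g :: "'v \<times> 'v \<Rightarrow> 'i \<Rightarrow> 'i \<Rightarrow> 'a::comm_ring_1"
  assumes "finite I" "distinct vs" "u \<notin> set vs" "y \<notin> set vs" "j \<in> I"
  shows "(\<Sum>c\<in>set vs \<rightarrow>\<^sub>E I. \<Prod>(a, b)\<leftarrow>zip (u # vs) (vs @ [y]).
      g (a, b) (if a = u then i else c a) (if b \<in> set vs then c b else j)) =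
    path_weight I g (zip (u # vs) (vs @ [y])) i j"
  using assms
proof (induction vs arbitrary: u i)
  case Nil
  then show ?case by (simp add: sum.delta of_bool_def mult.commute if_distrib cong: if_cong)
next
  case (Cons v vs)
  let ?f = "\<lambda>u vs i c (a, b). g (a, b) (if a = u then i else c a) (if b \<in> set vs then c b else j)"
  have eq: "map (?f u (v # vs) i (c(v := l))) (zip (u # v # vs) ((v # vs) @ [y])) =
      g (u, v) i l # map (?f v vs l c) (zip (v # vs) (vs @ [y]))" for c l
  proof -
    have "?f u (v # vs) i (c(v := l)) e = ?f v vs l c e" if "e \<in> set (zip (v # vs) (vs @ [y]))" for e
    proof -
      obtain a b where e: "e = (a, b)" by force
      have "a \<in> set (v # vs)" "b \<in> set (vs @ [y])" using that set_zip_leftD set_zip_rightD unfolding e by fast+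
      then show ?thesis using Cons.prems by (auto simp: e)
    qed
    then show ?thesis by simp
  qed
  let ?F = "\<lambda>c. \<Prod>e\<leftarrow>zip (u # v # vs) ((v # vs) @ [y]). ?f u (v # vs) i c e"
  have "(\<Sum>c\<in>set (v # vs) \<rightarrow>\<^sub>E I. ?F c) = (\<Sum>c\<in>insert v (set vs) \<rightarrow>\<^sub>E I. ?F c)"
    by (simp only: list.set(2))
  also have "\<dots> = (\<Sum>l\<in>I. \<Sum>c\<in>set vs \<rightarrow>\<^sub>E I. ?F (c(v := l)))"
    using Cons.prems by (intro sum_PiE_insert) auto
  also have "\<dots> = (\<Sum>l\<in>I. \<Sum>c\<in>set vs \<rightarrow>\<^sub>E I. g (u, v) i l * (\<Prod>e\<leftarrow>zip (v # vs) (vs @ [y]). ?f v vs l c e))"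
    by (simp only: eq prod_list.Cons)
  also have "\<dots> = (\<Sum>l\<in>I. g (u, v) i l * path_weight I g (zip (v # vs) (vs @ [y])) l j)"
    using Cons.prems by (simp only: sum_distrib_left[symmetric]) (intro sum.cong refl arg_cong2[where f = "(*)"] Cons.IH, auto)
  finally show ?case by simp
qed

text \<open>Cut the cycle open at its first vertex. The label there is both the row and the column
  index of the matrix product, so summing over it gives the trace.\<close>

lemma sum_cycle_trace:
  fixes g :: "'v \<times> 'v \<Rightarrow> 'i \<Rightarrow> 'i \<Rightarrow> 'a::comm_ring_1"
  assumes I: "finite I" and cs: "distinct cs" "cs \<noteq> []" "map \<sigma> cs = rotate1 cs"
  shows "(\<Sum>c\<in>set cs \<rightarrow>\<^sub>E I. \<Prod>u\<in>set cs. g (u, \<sigma> u) (c u) (c (\<sigma> u))) =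
    (\<Sum>i\<in>I. path_weight I g (cycle_arcs cs) i i)"
proof -
  obtain u vs where uv: "cs = u # vs" using cs by (cases cs) auto
  have arcs: "cycle_arcs cs = zip (u # vs) (vs @ [u])" by (simp add: cycle_arcs_def uv)
  have "(\<Prod>a\<in>set cs. g (a, \<sigma> a) (c a) (c (\<sigma> a))) = (\<Prod>(a, b)\<leftarrow>cycle_arcs cs. g (a, b) (c a) (c b))" for c
  proof -
    have "cycle_arcs cs = map (\<lambda>a. (a, \<sigma> a)) cs"
      unfolding cycle_arcs_def cs(3)[symmetric] by (simp add: zip_map2 zip_same_conv_map)
    then show ?thesis using cs(1) by (simp add: prod.distinct_set_conv_list comp_def)
  qed
  then have "(\<Sum>c\<in>set cs \<rightarrow>\<^sub>E I. \<Prod>u\<in>set cs. g (u, \<sigma> u) (c u) (c (\<sigma> u))) =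
      (\<Sum>i\<in>I. \<Sum>c\<in>set vs \<rightarrow>\<^sub>E I. \<Prod>(a, b)\<leftarrow>zip (u # vs) (vs @ [u]). g (a, b) ((c(u := i)) a) ((c(u := i)) b))"
    using cs(1) unfolding arcs by (simp only: uv list.set distinct.simps sum_PiE_insert not_False_eq_True)
  also have "\<dots> = (\<Sum>i\<in>I. path_weight I g (zip (u # vs) (vs @ [u])) i i)"
  proof (rule sum.cong[OF refl])
    fix i assume i: "i \<in> I"
    have "(\<Prod>(a, b)\<leftarrow>zip (u # vs) (vs @ [u]). g (a, b) ((c(u := i)) a) ((c(u := i)) b)) =
      (\<Prod>(a, b)\<leftarrow>zip (u # vs) (vs @ [u]). g (a, b) (if a = u then i else c a) (if b \<in> set vs then c b else i))" for c
    proof (intro arg_cong[where f = prod_list] map_cong refl)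
      fix e assume e: "e \<in> set (zip (u # vs) (vs @ [u]))"
      obtain a b where ab: "e = (a, b)" by force
      have "b \<in> set (vs @ [u])" using e set_zip_rightD unfolding ab by fast
      then show "(case e of (a, b) \<Rightarrow> g (a, b) ((c(u := i)) a) ((c(u := i)) b)) =
        (case e of (a, b) \<Rightarrow> g (a, b) (if a = u then i else c a) (if b \<in> set vs then c b else i))"
        using cs(1) by (auto simp: ab uv)
    qed
    then show "(\<Sum>c\<in>set vs \<rightarrow>\<^sub>E I. \<Prod>(a, b)\<leftarrow>zip (u # vs) (vs @ [u]). g (a, b) ((c(u := i)) a) ((c(u := i)) b)) =
      path_weight I g (zip (u # vs) (vs @ [u])) i i"
      using sum_path_weight[OF I, of vs u u i g i] cs(1) i by (simp only: uv distinct.simps not_False_eq_True simp_thms)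
  qed
  finally show ?thesis unfolding arcs .
qed

text \<open>The permutation maps each cycle to itself, so the factors of different cycles depend on
  disjoint sets of labels and the sum splits into a product.\<close>

lemma sum_permutation_traces:
  fixes g :: "'v \<times> 'v \<Rightarrow> 'i \<Rightarrow> 'i \<Rightarrow> 'a::comm_ring_1"
  assumes I: "finite I" and "cycle_lists V \<sigma> css"
  shows "(\<Sum>c\<in>V \<rightarrow>\<^sub>E I. \<Prod>u\<in>V. g (u, \<sigma> u) (c u) (c (\<sigma> u))) =
    (\<Prod>cs\<leftarrow>css. \<Sum>i\<in>I. path_weight I g (cycle_arcs cs) i i)"
  using assms(2)
proof (induction css arbitrary: V)
  case Nil
  then show ?case by (simp add: cycle_lists_def)
next
  case (Cons cs css)
  let ?W = "set (concat css)"
  let ?F = "\<lambda>A c. \<Prod>u\<in>A. g (u, \<sigma> u) (c u) (c (\<sigma> u))"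
  have V: "V = set cs \<union> ?W" and disj: "set cs \<inter> ?W = {}" and W: "cycle_lists ?W \<sigma> css"
    and cs: "distinct cs" "cs \<noteq> []" "map \<sigma> cs = rotate1 cs"
    using Cons.prems by (auto simp: cycle_lists_def)
  have "\<sigma> ` set cs = set cs" using arg_cong[OF cs(3), of set] by simp
  then have im1: "\<sigma> u \<in> set cs" if "u \<in> set cs" for u using that by auto
  have im2: "\<sigma> u \<in> ?W" if u: "u \<in> ?W" for u
  proof -
    obtain cs' where cs': "cs' \<in> set css" "u \<in> set cs'" using u by auto
    then have "map \<sigma> cs' = rotate1 cs'" using Cons.prems by (auto simp: cycle_lists_def)
    from arg_cong[OF this, of set] have "\<sigma> ` set cs' = set cs'" by simp
    then show ?thesis using cs' by auto
  qed
  have "(\<Sum>c\<in>V \<rightarrow>\<^sub>E I. ?F V c) = (\<Sum>c\<in>set cs \<union> ?W \<rightarrow>\<^sub>E I. ?F (set cs) c * ?F ?W c)"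
    unfolding V using disj by (simp add: prod.union_disjoint del: set_concat)
  also have "\<dots> = (\<Sum>c\<in>set cs \<rightarrow>\<^sub>E I. ?F (set cs) c) * (\<Sum>c\<in>?W \<rightarrow>\<^sub>E I. ?F ?W c)"
    using im1 im2 by (intro sum_PiE_Un disj prod.cong refl) (auto simp del: set_concat)
  also have "\<dots> = (\<Prod>cs\<leftarrow>cs # css. \<Sum>i\<in>I. path_weight I g (cycle_arcs cs) i i)"
    by (simp only: sum_cycle_trace[OF I cs] Cons.IH[OF W] list.map prod_list.Cons)
  finally show ?case .
qed

section \<open>The reduced regular representation\<close>

text \<open>
  The matrices of the right regular representation, repeated \<open>t\<close> times, minus the projection to
  the constant vectors.
\<close>

definition reduced_regular :: "nat \<Rightarrow> ('g, 'm) monoid_scheme \<Rightarrow> 'g \<Rightarrow> nat \<times> 'g \<Rightarrow> nat \<times> 'g \<Rightarrow> complex" where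
  "reduced_regular t \<Gamma> g i j =
     of_bool (j = (fst i, snd i \<otimes>\<^bsub>\<Gamma>\<^esub> g)) - 1 / of_nat (t * order \<Gamma>)"

context
  fixes \<Gamma> :: "('g, 'm) monoid_scheme" and t :: nat and I :: "(nat \<times> 'g) set"
  assumes \<Gamma>: "group \<Gamma>" "finite (carrier \<Gamma>)" and t: "t > 0"
  defines "I \<equiv> {..<t} \<times> carrier \<Gamma>"
begin

interpretation group \<Gamma> by (rule \<Gamma>)

lemma finite_index: "finite I" using \<Gamma> by (simp add: I_def)

lemma card_index: "card I = t * order \<Gamma>" by (simp add: I_def order_def card_cartesian_product)

lemma index_card_pos: "t * order \<Gamma> > 0"
  using t \<Gamma>(2) order_gt_0_iff_finite by simp

text \<open>A translation matrix fixes the projection to constants from either side. Hence the two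
  mixed terms and the square of the projection leave a single copy of it. Right translations
  multiply in reading order, so \<open>\<Gamma>\<close> need not be abelian.\<close>

lemma reduced_regular_mult:
  assumes "g \<in> carrier \<Gamma>" "h \<in> carrier \<Gamma>" "i \<in> I" "j \<in> I"
  shows "(\<Sum>l\<in>I. reduced_regular t \<Gamma> g i l * reduced_regular t \<Gamma> h l j) =
    reduced_regular t \<Gamma> (g \<otimes>\<^bsub>\<Gamma>\<^esub> h) i j"
proof -
  define N where "N = (of_nat (t * order \<Gamma>) :: complex)"
  have N: "N \<noteq> 0" using index_card_pos by (simp add: N_def)
  define m where "m = (fst i, snd i \<otimes>\<^bsub>\<Gamma>\<^esub> g)"
  define p where "p = (fst j, snd j \<otimes>\<^bsub>\<Gamma>\<^esub> inv\<^bsub>\<Gamma>\<^esub> h)"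
  have mp: "m \<in> I" "p \<in> I" using assms by (auto simp: m_def p_def I_def)
  have jp: "j = (fst l, snd l \<otimes>\<^bsub>\<Gamma>\<^esub> h) \<longleftrightarrow> l = p" if "l \<in> I" for l
    using that assms by (auto simp: p_def I_def prod_eq_iff m_assoc)
  have "m = p \<longleftrightarrow> j = (fst i, snd i \<otimes>\<^bsub>\<Gamma>\<^esub> (g \<otimes>\<^bsub>\<Gamma>\<^esub> h))"
    using jp[OF mp(1)] assms by (auto simp: m_def I_def m_assoc)
  then have rhs: "reduced_regular t \<Gamma> (g \<otimes>\<^bsub>\<Gamma>\<^esub> h) i j = of_bool (m = p) - 1 / N"
    unfolding reduced_regular_def N_def by simp
  have "(\<Sum>l\<in>I. reduced_regular t \<Gamma> g i l * reduced_regular t \<Gamma> h l j) =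
      (\<Sum>l\<in>I. (of_bool (l = m) - 1 / N) * (of_bool (l = p) - 1 / N))"
    unfolding reduced_regular_def using jp by (intro sum.cong) (auto simp: m_def N_def)
  also have "\<dots> = (\<Sum>l\<in>I. (if l = m then of_bool (m = p) else 0) - (if l = m then 1 / N else 0)
      - (if l = p then 1 / N else 0) + 1 / N\<^sup>2)"
    by (intro sum.cong refl) (auto simp: algebra_simps power2_eq_square)
  also have "\<dots> = of_bool (m = p) - 1 / N - 1 / N + N * (1 / N\<^sup>2)"
    using mp finite_index by (simp add: sum.distrib sum_subtractf card_index N_def)
  also have "\<dots> = of_bool (m = p) - 1 / N" using N by (simp add: power2_eq_square)
  finally show ?thesis unfolding rhs .
qed

text \<open>The sum is exactly \<open>1 - 1 / N\<close>: a row of a permutation matrix, projected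
  orthogonally.\<close>

lemma reduced_regular_row:
  assumes "g \<in> carrier \<Gamma>" "i \<in> I"
  shows "(\<Sum>j\<in>I. (norm (reduced_regular t \<Gamma> g i j))\<^sup>2) \<le> 1"
proof -
  define N where "N = real (t * order \<Gamma>)"
  have N: "N > 0" using index_card_pos unfolding N_def by (metis of_nat_0_less_iff)
  define m where "m = (fst i, snd i \<otimes>\<^bsub>\<Gamma>\<^esub> g)"
  have m: "m \<in> I" using assms by (auto simp: m_def I_def)
  have "norm (reduced_regular t \<Gamma> g i j) = \<bar>of_bool (j = m) - 1 / N\<bar>" for j
  proof -
    have "reduced_regular t \<Gamma> g i j = of_real (of_bool (j = m) - 1 / N)"
      by (simp add: reduced_regular_def m_def N_def)
    then show ?thesis by (simp only: norm_of_real)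
  qed
  then have "(\<Sum>j\<in>I. (norm (reduced_regular t \<Gamma> g i j))\<^sup>2) = (\<Sum>j\<in>I. (of_bool (j = m) - 1 / N)\<^sup>2)"
    by simp
  also have "\<dots> = (\<Sum>j\<in>I. (if j = m then 1 - 2 / N else 0) + 1 / N\<^sup>2)"
    by (intro sum.cong refl) (auto simp: power2_eq_square algebra_simps)
  also have "\<dots> = 1 - 2 / N + N * (1 / N\<^sup>2)"
    using m finite_index by (simp add: sum.distrib card_index N_def)
  also have "\<dots> \<le> 1" using N by (simp add: power2_eq_square field_simps)
  finally show ?thesis .
qed

text \<open>Right translation by an element other than the identity has no fixed point, and the
  projection has trace 1.\<close>

lemma reduced_regular_trace:
  assumes "g \<in> carrier \<Gamma>"
  shows "(\<Sum>i\<in>I. reduced_regular t \<Gamma> g i i) = of_nat (t * order \<Gamma>) * of_bool (g = \<one>\<^bsub>\<Gamma>\<^esub>) - 1"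
proof -
  have "i = (fst i, snd i \<otimes>\<^bsub>\<Gamma>\<^esub> g) \<longleftrightarrow> g = \<one>\<^bsub>\<Gamma>\<^esub>" if "i \<in> I" for i
    using that assms by (auto simp: I_def r_cancel_one')
  then have "(\<Sum>i\<in>I. reduced_regular t \<Gamma> g i i) =
      (\<Sum>i\<in>I. of_bool (g = \<one>\<^bsub>\<Gamma>\<^esub>) - 1 / of_nat (t * order \<Gamma>))"
    unfolding reduced_regular_def by (intro sum.cong) auto
  also have "\<dots> = of_nat (t * order \<Gamma>) * of_bool (g = \<one>\<^bsub>\<Gamma>\<^esub>) - 1"
    using index_card_pos by (simp add: card_index right_diff_distrib del: of_nat_mult)
  finally show ?thesis .
qed

lemma label_product_closed:
  "w \<in> set es \<rightarrow> carrier \<Gamma> \<Longrightarrow> label_product \<Gamma> w es \<in> carrier \<Gamma>"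
  by (induction es) (auto simp: label_product_def)

text \<open>The empty path gives the identity matrix, whereas the identity of
  \<open>\<Gamma>\<close> is represented by a proper projection; hence the restriction to nonempty
  lists.\<close>

lemma path_weight_reduced_regular:
  assumes "es \<noteq> []" "w \<in> set es \<rightarrow> carrier \<Gamma>" "i \<in> I" "j \<in> I"
  shows "path_weight I (\<lambda>e. reduced_regular t \<Gamma> (w e)) es i j =
    reduced_regular t \<Gamma> (label_product \<Gamma> w es) i j"
  using assms
proof (induction es arbitrary: i)
  case (Cons e es)
  show ?case
  proof (cases "es = []")
    case True
    have "(\<Sum>l\<in>I. reduced_regular t \<Gamma> (w e) i l * of_bool (l = j)) =
        (\<Sum>l\<in>I. if l = j then reduced_regular t \<Gamma> (w e) i j else 0)"
      by (intro sum.cong) auto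
    then show ?thesis using True Cons.prems finite_index by (simp add: label_product_def)
  next
    case False
    then show ?thesis
      using Cons reduced_regular_mult[of "w e" "label_product \<Gamma> w es" i j] label_product_closed[of w es]
      by (simp add: label_product_def)
  qed
qed simp

end

section \<open>A cycle factor with many zero-sum cycles\<close>

definition cycle_factors :: "'v set \<Rightarrow> ('v \<times> 'v) set \<Rightarrow> ('v \<Rightarrow> 'v) set" where
  "cycle_factors V E = {\<sigma>. \<sigma> permutes V \<and> (\<forall>v\<in>V. (v, \<sigma> v) \<in> E)}"

definition zero_sum_lists :: "('g, 'm) monoid_scheme \<Rightarrow> ('v \<times> 'v \<Rightarrow> 'g) \<Rightarrow> 'v list list \<Rightarrow> 'v list list" where
  "zero_sum_lists \<Gamma> w css = filter (\<lambda>cs. label_product \<Gamma> w (cycle_arcs cs) = \<one>\<^bsub>\<Gamma>\<^esub>) css"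

lemma cycle_listsD:
  assumes "cycle_lists V \<sigma> css" "cs \<in> set css"
  shows "cycle_arcs cs = map (\<lambda>v. (v, \<sigma> v)) cs" "set cs \<subseteq> V" "cs \<noteq> []" "distinct cs"
proof -
  have cs: "map \<sigma> cs = rotate1 cs" using assms by (auto simp: cycle_lists_def)
  show "cycle_arcs cs = map (\<lambda>v. (v, \<sigma> v)) cs"
    unfolding cycle_arcs_def cs[symmetric] by (simp add: zip_map2 zip_same_conv_map)
  show "set cs \<subseteq> V" "cs \<noteq> []" "distinct cs"
    using assms by (auto simp: cycle_lists_def distinct_concat_iff)
qed

text \<open>A cycle contributes \<open>(- 1) ^ length cs\<close>, times \<open>1 - N\<close> if it
  is zero-sum. The lengths add up to the number of vertices, so the resulting sign is the same for
  every permutation.\<close>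

lemma prod_list_zero_sum:
  fixes N :: complex
  shows "(\<Prod>cs\<leftarrow>css. (- 1) ^ (length cs + 1)) *
      (\<Prod>cs\<leftarrow>css. N * of_bool (label_product \<Gamma> w (cycle_arcs cs) = \<one>\<^bsub>\<Gamma>\<^esub>) - 1) =
    (- 1) ^ length (concat css) * (1 - N) ^ length (zero_sum_lists \<Gamma> w css)"
  by (induction css) (auto simp: zero_sum_lists_def power_add algebra_simps)

text \<open>The matrix \<open>M\<close> has one block of rows per vertex. A transversal chooses a
  label in each block, and summing the minors over all labellings turns every permutation into the
  product of the traces of its cycles. A row meets at most \<open>d\<close> nonzero blocks, each
  contributing at most 1 to its squared length.\<close>

lemma zero_sum_lists_character_bound:
  fixes \<Gamma> :: "('g, 'm) monoid_scheme" and V :: "'v set"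
  assumes \<Gamma>: "group \<Gamma>" "finite (carrier \<Gamma>)" and t: "t > 0" and d: "d > 0"
    and V: "finite V" and irrefl: "\<And>v. v \<in> V \<Longrightarrow> (v, v) \<notin> E"
    and out: "\<And>u. u \<in> V \<Longrightarrow> card {v \<in> V. (u, v) \<in> E} \<le> d"
    and w: "w \<in> E \<rightarrow> carrier \<Gamma>"
    and C: "\<And>\<sigma>. \<sigma> \<in> cycle_factors V E \<Longrightarrow> cycle_lists V \<sigma> (C \<sigma>) \<and>
      sign \<sigma> = (\<Prod>cs\<leftarrow>C \<sigma>. (- 1) ^ (length cs + 1))"
  shows "(\<Sum>\<sigma>\<in>cycle_factors V E. (1 - real (t * order \<Gamma>)) ^ length (zero_sum_lists \<Gamma> w (C \<sigma>)))\<^sup>2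
    \<le> (exp 1 * real d * real (t * order \<Gamma>)) ^ card V"
proof -
  define I where "I = {..<t} \<times> carrier \<Gamma>"
  define N where "N = t * order \<Gamma>"
  have N: "N > 0" using index_card_pos[OF \<Gamma> t] by (simp add: N_def)
  have I: "finite I" "card I = N" using finite_index[OF \<Gamma> t] card_index[OF \<Gamma> t] by (auto simp: I_def N_def)
  then have "I \<noteq> {}" using N by auto
  define g where "g e = reduced_regular t \<Gamma> (w e)" for e
  define M where "M s s' = of_bool ((fst s, fst s') \<in> E) * g (fst s, fst s') (snd s) (snd s')" for s s'
  \<comment> \<open>This choice turns the Hadamard bound \<open>(1 + r^2 * d) ^ (n * N)\<close> into
    \<open>(1 + 1 / N) ^ (n * N)\<close>, which is at most \<open>exp 1 ^ n\<close>.\<close>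
  define r where "r = 1 / sqrt (real d * real N)"
  have r: "r > 0" "r\<^sup>2 = 1 / (real d * real N)" using N d by (auto simp: r_def power_divide)
  have row: "(\<Sum>s'\<in>V \<times> I. (norm (M s s'))\<^sup>2) \<le> real d" if s: "s \<in> V \<times> I" for s
  proof -
    obtain u i where ui: "s = (u, i)" "u \<in> V" "i \<in> I" using s by auto
    have "(\<Sum>s'\<in>V \<times> I. (norm (M s s'))\<^sup>2) = (\<Sum>v\<in>V. \<Sum>j\<in>I. (norm (M s (v, j)))\<^sup>2)"
      using V I by (simp add: sum.cartesian_product split_def)
    also have "\<dots> = (\<Sum>v\<in>V. if (u, v) \<in> E then \<Sum>j\<in>I. (norm (g (u, v) i j))\<^sup>2 else 0)"
      by (intro sum.cong) (auto simp: M_def ui)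
    also have "\<dots> \<le> (\<Sum>v\<in>V. if (u, v) \<in> E then 1 else 0)"
    proof (intro sum_mono)
      fix v
      show "(if (u, v) \<in> E then \<Sum>j\<in>I. (norm (g (u, v) i j))\<^sup>2 else 0) \<le> (if (u, v) \<in> E then 1 else 0)"
        using reduced_regular_row[OF \<Gamma> t, of "w (u, v)" i] w ui unfolding g_def I_def by auto
    qed
    also have "\<dots> = real (card {v \<in> V. (u, v) \<in> E})" using V by (simp add: sum.If_cases Int_def)
    also have "\<dots> \<le> real d" using out ui by simp
    finally show ?thesis .
  qed
  have diag: "M s s = 0" if "s \<in> V \<times> I" for s using irrefl that by (auto simp: M_def)
  define S where "S = (\<Sum>c\<in>V \<rightarrow>\<^sub>E I. set_det V (\<lambda>u v. M (u, c u) (v, c v)))"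
  define X where "X = (\<Sum>\<sigma>\<in>cycle_factors V E. (1 - real N) ^ length (zero_sum_lists \<Gamma> w (C \<sigma>)))"
  have term_eq: "(\<Sum>c\<in>V \<rightarrow>\<^sub>E I. of_int (sign \<sigma>) * (\<Prod>u\<in>V. M (u, c u) (\<sigma> u, c (\<sigma> u)))) =
      (if \<sigma> \<in> cycle_factors V E then (- 1) ^ card V * of_real ((1 - real N) ^ length (zero_sum_lists \<Gamma> w (C \<sigma>))) else 0)"
    if \<sigma>: "\<sigma> permutes V" for \<sigma>
  proof (cases "\<sigma> \<in> cycle_factors V E")
    case True
    then have css: "cycle_lists V \<sigma> (C \<sigma>)" and sgn: "sign \<sigma> = (\<Prod>cs\<leftarrow>C \<sigma>. (- 1) ^ (length cs + 1))"
      using C by auto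
    have E: "(u, \<sigma> u) \<in> E" if "u \<in> V" for u using True that by (auto simp: cycle_factors_def)
    have "(\<Sum>c\<in>V \<rightarrow>\<^sub>E I. of_int (sign \<sigma>) * (\<Prod>u\<in>V. M (u, c u) (\<sigma> u, c (\<sigma> u)))) =
        of_int (sign \<sigma>) * (\<Sum>c\<in>V \<rightarrow>\<^sub>E I. \<Prod>u\<in>V. g (u, \<sigma> u) (c u) (c (\<sigma> u)))"
      using E by (simp add: M_def flip: sum_distrib_left)
    also have "\<dots> = of_int (sign \<sigma>) * (\<Prod>cs\<leftarrow>C \<sigma>. \<Sum>i\<in>I. path_weight I g (cycle_arcs cs) i i)"
      by (simp only: sum_permutation_traces[OF I(1) css])
    also have "(\<Prod>cs\<leftarrow>C \<sigma>. \<Sum>i\<in>I. path_weight I g (cycle_arcs cs) i i) =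
        (\<Prod>cs\<leftarrow>C \<sigma>. of_nat N * of_bool (label_product \<Gamma> w (cycle_arcs cs) = \<one>\<^bsub>\<Gamma>\<^esub>) - 1)"
    proof (intro arg_cong[where f = prod_list] map_cong refl)
      fix cs assume cs: "cs \<in> set (C \<sigma>)"
      note arcs = cycle_listsD[OF css cs]
      have wE: "w \<in> set (cycle_arcs cs) \<rightarrow> carrier \<Gamma>" using w E arcs by auto
      have "(\<Sum>i\<in>I. path_weight I g (cycle_arcs cs) i i) =
          (\<Sum>i\<in>I. reduced_regular t \<Gamma> (label_product \<Gamma> w (cycle_arcs cs)) i i)"
        using path_weight_reduced_regular[OF \<Gamma> t _ wE] arcs(1,3)
        unfolding g_def I_def by (intro sum.cong refl) auto
      also have "\<dots> = of_nat N * of_bool (label_product \<Gamma> w (cycle_arcs cs) = \<one>\<^bsub>\<Gamma>\<^esub>) - 1"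
        using reduced_regular_trace[OF \<Gamma> t label_product_closed[OF \<Gamma> t wE]] by (simp add: I_def N_def)
      finally show "(\<Sum>i\<in>I. path_weight I g (cycle_arcs cs) i i) =
        of_nat N * of_bool (label_product \<Gamma> w (cycle_arcs cs) = \<one>\<^bsub>\<Gamma>\<^esub>) - 1" .
    qed
    also have "of_int (sign \<sigma>) * \<dots> = (- 1) ^ length (concat (C \<sigma>)) * (1 - of_nat N) ^ length (zero_sum_lists \<Gamma> w (C \<sigma>))"
    proof -
      have "complex_of_int (\<Prod>cs\<leftarrow>css. (- 1) ^ (length cs + 1)) = (\<Prod>cs\<leftarrow>css. (- 1) ^ (length cs + 1))" for css :: "'v list list"
        by (induction css) auto
      then show ?thesis by (simp only: sgn prod_list_zero_sum)
    qed
    also have "length (concat (C \<sigma>)) = card V"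
      using css unfolding cycle_lists_def by (metis distinct_card)
    finally show ?thesis using True by simp
  next
    case False
    then obtain u where "u \<in> V" "(u, \<sigma> u) \<notin> E" using \<sigma> by (auto simp: cycle_factors_def)
    then have "(\<Prod>u\<in>V. M (u, c u) (\<sigma> u, c (\<sigma> u))) = 0" for c
      using V by (intro prod_zero) (auto simp: M_def)
    then show ?thesis using False by simp
  qed
  have "S = (\<Sum>\<sigma> | \<sigma> permutes V. \<Sum>c\<in>V \<rightarrow>\<^sub>E I. of_int (sign \<sigma>) * (\<Prod>u\<in>V. M (u, c u) (\<sigma> u, c (\<sigma> u))))"
    unfolding S_def set_det_def by (rule sum.swap)
  also have "\<dots> = (\<Sum>\<sigma> | \<sigma> permutes V. if \<sigma> \<in> cycle_factors V E
      then (- 1) ^ card V * of_real ((1 - real N) ^ length (zero_sum_lists \<Gamma> w (C \<sigma>))) else 0)"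
    by (intro sum.cong refl) (simp only: term_eq mem_Collect_eq)
  also have "\<dots> = (\<Sum>\<sigma>\<in>cycle_factors V E. (- 1) ^ card V * of_real ((1 - real N) ^ length (zero_sum_lists \<Gamma> w (C \<sigma>))))"
    using finite_permutations[OF V] by (intro sum.mono_neutral_cong_right) (auto simp: cycle_factors_def)
  also have "\<dots> = (- 1) ^ card V * of_real X" by (simp add: X_def sum_distrib_left)
  finally have "norm S = \<bar>X\<bar>" by (simp add: norm_mult norm_power)
  then have "(r ^ card V * \<bar>X\<bar>)\<^sup>2 \<le> (1 + r\<^sup>2 * real d) ^ (card V * card I)"
    using transversal_minors_bound[OF V I(1) \<open>I \<noteq> {}\<close> r(1), where R = "real d" and M = M, OF diag row]
    by (simp add: S_def)
  moreover have "(r ^ card V * \<bar>X\<bar>)\<^sup>2 = (r\<^sup>2) ^ card V * X\<^sup>2"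
    by (simp add: power_mult_distrib mult.commute flip: power_mult)
  moreover have "(1 + r\<^sup>2 * real d) ^ (card V * card I) = ((1 + 1 / real N) ^ N) ^ card V"
    using d by (simp add: r(2) I(2) mult.commute flip: power_mult)
  ultimately have "(r\<^sup>2) ^ card V * X\<^sup>2 \<le> ((1 + 1 / real N) ^ N) ^ card V" by simp
  also have "\<dots> \<le> exp 1 ^ card V"
    using exp_ge_one_plus_x_over_n_power_n[of N 1] N by (intro power_mono) auto
  finally have "X\<^sup>2 \<le> exp 1 ^ card V * (real d * real N) ^ card V"
    using d N unfolding r(2) by (simp add: power_divide field_simps)
  then show ?thesis by (simp add: X_def N_def power_mult_distrib mult_ac)
qed

text \<open>A \<open>T\<close>-th finite difference kills polynomials of degree below
  \<open>T\<close>. Splitting off one factor \<open>a - t * k\<close> and absorbing \<open>t\<close>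
  into the binomial coefficient lowers \<open>T\<close> and shifts \<open>a\<close> by
  \<open>k\<close>, which is why \<open>a\<close> is arbitrary.\<close>

lemma alternating_sum_power_eq_0:
  fixes a k :: "'a::comm_ring_1"
  assumes "z < T"
  shows "(\<Sum>t\<le>T. (- 1) ^ t * of_nat (T choose t) * (a - of_nat t * k) ^ z) = 0"
  using assms
proof (induction z arbitrary: a T)
  case 0
  then show ?case using choose_alternating_sum[of T, where 'a = 'a] by simp
next
  case (Suc z)
  obtain T' where T: "T = Suc T'" using Suc.prems by (cases T) auto
  let ?f = "\<lambda>T a t. (- 1) ^ t * of_nat (T choose t) * (a - of_nat t * k) ^ z"
  have absorb: "of_nat (Suc t) * of_nat (T choose Suc t) = of_nat T * (of_nat (T' choose t) :: 'a)" for t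
    unfolding of_nat_mult[symmetric] T by (simp only: Suc_times_binomial)
  have "(\<Sum>t\<le>T. of_nat t * ?f T a t) = (\<Sum>t\<le>T'. of_nat (Suc t) * ?f T a (Suc t))"
    unfolding T by (subst sum.atMost_Suc_shift) simp
  also have "\<dots> = (\<Sum>t\<le>T'. - (of_nat T * ?f T' (a - k) t))"
  proof (rule sum.cong[OF refl])
    fix t
    have "of_nat (Suc t) * ?f T a (Suc t) =
        - ((- 1) ^ t * (of_nat (Suc t) * of_nat (T choose Suc t)) * (a - k - of_nat t * k) ^ z)"
      by (simp add: algebra_simps)
    then show "of_nat (Suc t) * ?f T a (Suc t) = - (of_nat T * ?f T' (a - k) t)"
      unfolding absorb by (simp add: mult_ac)
  qed
  also have "\<dots> = 0"
    using Suc.IH[of T' "a - k"] Suc.prems T by (simp add: sum_negf flip: sum_distrib_left)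
  finally have shift: "(\<Sum>t\<le>T. of_nat t * ?f T a t) = 0" .
  have "(\<Sum>t\<le>T. (- 1) ^ t * of_nat (T choose t) * (a - of_nat t * k) ^ Suc z) =
      (\<Sum>t\<le>T. a * ?f T a t - k * (of_nat t * ?f T a t))"
    by (intro sum.cong refl) (simp add: algebra_simps)
  also have "\<dots> = a * (\<Sum>t\<le>T. ?f T a t) - k * (\<Sum>t\<le>T. of_nat t * ?f T a t)"
    by (simp only: sum_subtractf sum_distrib_left)
  also have "\<dots> = 0" using Suc.IH[of T a] Suc.prems shift by simp
  finally show ?case .
qed

text \<open>The value 14/5 is small enough for its cube to stay below \<open>25 * (9 / 10)\<close>.
  The quadratic bound for \<open>exp\<close> gives only 3 at the point 1, hence the detour through
  1/16.\<close>

lemma exp_1_le: "exp 1 \<le> (14 / 5 :: real)"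
proof -
  have "exp 1 = exp (1 / 16 :: real) ^ 16" by (simp flip: exp_of_nat_mult)
  also have "\<dots> \<le> (1 + 1 / 16 + (1 / 16)\<^sup>2) ^ 16" by (intro power_mono exp_bound) auto
  also have "\<dots> = (273 / 256 :: real) ^ 16" by (simp add: power2_eq_square)
  also have "\<dots> \<le> 14 / 5" by (simp add: power_divide)
  finally show ?thesis .
qed

text \<open>With arcs as pairs, removing a cycle factor is a set difference and stays within the
  same notion.\<close>

definition regular_relation :: "'v set \<Rightarrow> ('v \<times> 'v) set \<Rightarrow> nat \<Rightarrow> bool" where
  "regular_relation V E d \<longleftrightarrow> finite V \<and> E \<subseteq> V \<times> V \<and>
     (\<forall>v\<in>V. (v, v) \<notin> E \<and> card {u. (v, u) \<in> E} = d \<and> card {u. (u, v) \<in> E} = d)"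

lemma regular_relation_restrict:
  assumes "regular_relation V E d" "v \<in> V"
  shows "{u \<in> V. (v, u) \<in> E} = {u. (v, u) \<in> E}" "{u \<in> V. (u, v) \<in> E} = {u. (u, v) \<in> E}"
  using assms by (auto simp: regular_relation_def)

lemma card_cycle_factors_ge:
  assumes reg: "regular_relation V E d"
  shows "real (card (cycle_factors V E)) \<ge> (real d / exp 1) ^ card V"
proof -
  have V: "finite V" using reg by (simp add: regular_relation_def)
  have "(\<Sum>\<sigma> | \<sigma> permutes V. \<Prod>v\<in>V. of_bool ((v, \<sigma> v) \<in> E)) \<ge> (real d / exp 1) ^ card V"
    using V regular_relation_restrict[OF reg] reg
    by (intro permanent_ge) (auto simp: regular_relation_def of_bool_def sum.If_cases Int_def)
  also have "(\<Sum>\<sigma> | \<sigma> permutes V. \<Prod>v\<in>V. of_bool ((v, \<sigma> v) \<in> E)) = (\<Sum>\<sigma>\<in>cycle_factors V E. 1::real)"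
  proof (intro sum.mono_neutral_cong_right finite_permutations V ballI)
    fix \<sigma> assume "\<sigma> \<in> {\<sigma>. \<sigma> permutes V} - cycle_factors V E"
    then have "\<exists>v\<in>V. (v, \<sigma> v) \<notin> E" by (auto simp: cycle_factors_def)
    then show "(\<Prod>v\<in>V. of_bool ((v, \<sigma> v) \<in> E)) = (0::real)" using V by (intro prod_zero) auto
  qed (auto simp: cycle_factors_def)
  finally show ?thesis by simp
qed

lemma cycle_factor_with_zero_sums:
  fixes \<Gamma> :: "('g, 'm) monoid_scheme"
  assumes \<Gamma>: "group \<Gamma>" "finite (carrier \<Gamma>)" and k: "order \<Gamma> \<ge> 2"
    and reg: "regular_relation V E d" and "V \<noteq> {}" and d: "d > 0"
    and w: "w \<in> E \<rightarrow> carrier \<Gamma>" and T: "25 * order \<Gamma> * T \<le> d"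
  obtains \<sigma> css where "\<sigma> \<in> cycle_factors V E" "cycle_lists V \<sigma> css"
    "length (zero_sum_lists \<Gamma> w css) \<ge> T"
proof -
  define k' where "k' = order \<Gamma>"
  define n where "n = card V"
  define CF where "CF = cycle_factors V E"
  have V: "finite V" using reg by (simp add: regular_relation_def)
  have "\<exists>css. cycle_lists V \<sigma> css \<and> sign \<sigma> = (\<Prod>cs\<leftarrow>css. (- 1) ^ (length cs + 1))" if "\<sigma> \<in> CF" for \<sigma>
    using that permutation_cycle_lists[OF _ V, of \<sigma>] by (auto simp: CF_def cycle_factors_def)
  then obtain C where C: "\<And>\<sigma>. \<sigma> \<in> CF \<Longrightarrow> cycle_lists V \<sigma> (C \<sigma>) \<and>
      sign \<sigma> = (\<Prod>cs\<leftarrow>C \<sigma>. (- 1) ^ (length cs + 1))" by metis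
  define z where "z \<sigma> = length (zero_sum_lists \<Gamma> w (C \<sigma>))" for \<sigma>
  have many: "real (card CF) \<ge> (real d / exp 1) ^ n"
    unfolding CF_def n_def by (rule card_cycle_factors_ge[OF reg])
  have pos: "(real d / exp 1) ^ n > 0" using d by simp
  have "\<exists>\<sigma>\<in>CF. z \<sigma> \<ge> T"
  proof (rule ccontr)
    assume "\<not> (\<exists>\<sigma>\<in>CF. z \<sigma> \<ge> T)"
    then have few: "z \<sigma> < T" if "\<sigma> \<in> CF" for \<sigma> using that by force
    have "CF \<noteq> {}" using many pos by (metis card.empty not_less of_nat_0)
    \<comment> \<open>Positivity of \<open>T\<close> makes the final power strictly less than
      1.\<close>
    then have T0: "T > 0" using few by force
    define F where "F t = (\<Sum>\<sigma>\<in>CF. (1 - real (t * k')) ^ z \<sigma>)" for t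
    define B where "B = sqrt ((exp 1 * real d * real (T * k')) ^ n)"
    have F_le: "\<bar>F t\<bar> \<le> B" if t: "t > 0" "t \<le> T" for t
    proof -
      have "(F t)\<^sup>2 \<le> (exp 1 * real d * real (t * k')) ^ n"
        unfolding F_def k'_def z_def CF_def n_def
        using regular_relation_restrict[OF reg] reg C
        by (intro zero_sum_lists_character_bound \<Gamma> t d V w) (auto simp: regular_relation_def CF_def)
      also have "\<dots> \<le> (exp 1 * real d * real (T * k')) ^ n"
        using t by (intro power_mono mult_left_mono) (auto intro: mult_right_mono)
      finally have "\<bar>F t\<bar>\<^sup>2 \<le> (exp 1 * real d * real (T * k')) ^ n" by simp
      then show ?thesis unfolding B_def by (rule real_le_rsqrt)
    qed
    have "(\<Sum>t\<le>T. (- 1) ^ t * real (T choose t) * F t) =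
        (\<Sum>\<sigma>\<in>CF. \<Sum>t\<le>T. (- 1) ^ t * real (T choose t) * (1 - real t * real k') ^ z \<sigma>)"
      unfolding F_def sum_distrib_left by (subst sum.swap) simp
    \<comment> \<open>For each cycle factor this is a \<open>T\<close>-th difference of a polynomial
      in \<open>t\<close> of degree \<open>z \<sigma>\<close>, which is below \<open>T\<close> by
      assumption.\<close>
    also have "\<dots> = 0" using few by (intro sum.neutral ballI alternating_sum_power_eq_0)
    finally have "F 0 = - (\<Sum>t<T. (- 1) ^ Suc t * real (T choose Suc t) * F (Suc t))"
      unfolding sum.atMost_shift by simp
    also have "\<dots> \<le> (\<Sum>t<T. \<bar>(- 1) ^ Suc t * real (T choose Suc t) * F (Suc t)\<bar>)"
      using sum_abs[of "\<lambda>t. (- 1) ^ Suc t * real (T choose Suc t) * F (Suc t)" "{..<T}"] by linarith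
    also have "\<dots> \<le> (\<Sum>t<T. real (T choose Suc t) * B)"
      using F_le by (intro sum_mono) (auto simp: abs_mult power_abs intro!: mult_left_mono)
    also have "\<dots> \<le> (\<Sum>t\<le>T. real (T choose t) * B)"
      unfolding sum.atMost_shift by (simp add: B_def)
    also have "\<dots> = 2 ^ T * B"
      unfolding sum_distrib_right[symmetric] of_nat_sum[symmetric] choose_row_sum by simp
    \<comment> \<open>At \<open>t = 0\<close> every base is 1, so \<open>F\<close> merely
      counts.\<close>
    also have "F 0 = card CF" by (simp add: F_def)
    finally have "(real d / exp 1) ^ n \<le> 2 ^ T * B" using many by simp
    then have "((real d / exp 1) ^ n)\<^sup>2 \<le> (2 ^ T * B)\<^sup>2" using pos by (intro power_mono) auto
    also have "\<dots> = 4 ^ T * (exp 1 * real d * real (T * k')) ^ n"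
    proof -
      have "(2 ^ T)\<^sup>2 = (2\<^sup>2 :: real) ^ T" by (simp only: mult.commute flip: power_mult)
      then show ?thesis by (simp add: B_def power_mult_distrib)
    qed
    also have "\<dots> \<le> 4 ^ T * (exp 1 * real d * (real d / 25)) ^ n"
      using T of_nat_mono[OF T, where 'a = real]
      by (intro mult_left_mono power_mono) (auto simp: k'_def mult_ac)
    finally have "((real d)\<^sup>2) ^ n / (exp 1 ^ 2) ^ n \<le> 4 ^ T * (exp 1 / 25) ^ n * ((real d)\<^sup>2) ^ n"
      by (simp add: power_divide power_mult_distrib power2_eq_square mult_ac)
    then have "1 / (exp 1 ^ 2) ^ n \<le> 4 ^ T * (exp 1 / 25 :: real) ^ n"
      using d by (simp add: field_simps)
    then have "1 \<le> 4 ^ T * (exp 1 / 25 * exp 1 ^ 2 :: real) ^ n"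
      by (simp add: field_simps power_mult_distrib)
    also have "\<dots> = 4 ^ T * (exp 1 ^ 3 / 25 :: real) ^ n"
      by (simp add: power2_eq_square power3_eq_cube mult_ac)
    also have "\<dots> \<le> 4 ^ T * (9 / 10) ^ n"
    proof (intro mult_left_mono power_mono)
      have "exp 1 ^ 3 \<le> (14 / 5 :: real) ^ 3" using exp_1_le by (intro power_mono) auto
      also have "\<dots> \<le> 25 * (9 / 10)" by (simp add: power3_eq_cube)
      finally show "exp 1 ^ 3 / 25 \<le> (9 / 10 :: real)" by simp
    qed auto
    \<comment> \<open>A vertex has \<open>d\<close> out-neighbours, so
      \<open>n >= d >= 25 * k * T >= 50 * T\<close>; and \<open>4 * (9 / 10) ^ 50\<close> is below
      1.\<close>
    also have "\<dots> \<le> 4 ^ T * (9 / 10) ^ (50 * T)"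
    proof (intro mult_left_mono power_decreasing)
      obtain v where v: "v \<in> V" using \<open>V \<noteq> {}\<close> by auto
      have "d = card {u. (v, u) \<in> E}" using reg v by (simp add: regular_relation_def)
      also have "\<dots> \<le> n" unfolding n_def using V reg by (intro card_mono) (auto simp: regular_relation_def)
      finally have "d \<le> n" .
      moreover have "50 * T \<le> 25 * order \<Gamma> * T" using k by simp
      ultimately show "50 * T \<le> n" using T by linarith
    qed auto
    also have "\<dots> = (4 * (9 / 10) ^ 50) ^ T" by (simp only: power_mult power_mult_distrib)
    also have "\<dots> < 1" using T0 by (intro power_less_one_iff[THEN iffD2] conjI) (auto simp: power_divide)
    finally show False by simp
  qed
  then obtain \<sigma> where "\<sigma> \<in> CF" "z \<sigma> \<ge> T" by auto
  then show thesis using that[of \<sigma> "C \<sigma>"] C by (auto simp: CF_def z_def)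
qed

section \<open>Edge-disjoint zero-sum cycles\<close>

lemma regular_relation_remove_cycle_factor:
  assumes reg: "regular_relation V E (Suc d)" and \<sigma>: "\<sigma> \<in> cycle_factors V E"
  shows "regular_relation V (E - (\<lambda>v. (v, \<sigma> v)) ` V) d"
proof -
  let ?E = "E - (\<lambda>v. (v, \<sigma> v)) ` V"
  have perm: "\<sigma> permutes V" and arc: "\<And>v. v \<in> V \<Longrightarrow> (v, \<sigma> v) \<in> E"
    using \<sigma> by (auto simp: cycle_factors_def)
  have fin: "finite V" "E \<subseteq> V \<times> V" using reg by (auto simp: regular_relation_def)
  have "card {u. (v, u) \<in> ?E} = d" if v: "v \<in> V" for v
  proof -
    have "{u. (v, u) \<in> ?E} = {u. (v, u) \<in> E} - {\<sigma> v}" using v by auto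
    moreover have "finite {u. (v, u) \<in> E}" using fin by (auto intro: finite_subset[of _ V])
    ultimately show ?thesis using reg arc[OF v] v by (simp add: regular_relation_def)
  qed
  moreover have "card {u. (u, v) \<in> ?E} = d" if v: "v \<in> V" for v
  proof -
    have pre: "inv_into UNIV \<sigma> v \<in> V" "\<sigma> (inv_into UNIV \<sigma> v) = v"
      using v permutes_in_image[OF permutes_inv[OF perm]] permutes_inverses[OF perm] by auto
    have "{u. (u, v) \<in> ?E} = {u. (u, v) \<in> E} - {inv_into UNIV \<sigma> v}"
      using pre permutes_inverses(2)[OF perm] by force
    moreover have "finite {u. (u, v) \<in> E}" using fin by (auto intro: finite_subset[of _ V])
    ultimately show ?thesis using reg arc[OF pre(1)] pre(2) v by (simp add: regular_relation_def)
  qed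
  ultimately show ?thesis using reg by (auto simp: regular_relation_def)
qed

text \<open>Cycles of one factor share no vertex and hence no arc, and later cycles avoid the arcs
  of all factors already removed. The stage of degree \<open>x\<close> contributes at least
  \<open>x div (25 * k)\<close> cycles.\<close>

lemma disjoint_zero_sum_cycles:
  fixes \<Gamma> :: "('g, 'm) monoid_scheme"
  assumes \<Gamma>: "group \<Gamma>" "finite (carrier \<Gamma>)" and k: "order \<Gamma> \<ge> 2" and V: "V \<noteq> {}"
    and reg: "regular_relation V E d" and w: "w \<in> E \<rightarrow> carrier \<Gamma>"
  shows "\<exists>F. finite F \<and> (\<forall>cs\<in>F. cs \<noteq> [] \<and> distinct cs \<and> set (cycle_arcs cs) \<subseteq> E \<and>
      label_product \<Gamma> w (cycle_arcs cs) = \<one>\<^bsub>\<Gamma>\<^esub>) \<and>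
    pairwise (\<lambda>cs cs'. set (cycle_arcs cs) \<inter> set (cycle_arcs cs') = {}) F \<and>
    card F \<ge> (\<Sum>x\<le>d. x div (25 * order \<Gamma>))"
  using reg w
proof (induction d arbitrary: E)
  case 0
  then show ?case by (intro exI[of _ "{}"]) auto
next
  case (Suc d)
  define T where "T = Suc d div (25 * order \<Gamma>)"
  have "25 * order \<Gamma> * T \<le> Suc d" unfolding T_def by simp
  then obtain \<sigma> css where \<sigma>: "\<sigma> \<in> cycle_factors V E" and css: "cycle_lists V \<sigma> css"
    and T: "length (zero_sum_lists \<Gamma> w css) \<ge> T"
    using cycle_factor_with_zero_sums[OF \<Gamma> k Suc.prems(1) V _ Suc.prems(2), of T] by auto
  define E' where "E' = E - (\<lambda>v. (v, \<sigma> v)) ` V"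
  have "regular_relation V E' d"
    unfolding E'_def by (rule regular_relation_remove_cycle_factor[OF Suc.prems(1) \<sigma>])
  moreover have "w \<in> E' \<rightarrow> carrier \<Gamma>" using Suc.prems(2) by (auto simp: E'_def)
  ultimately obtain F where F: "finite F"
    "\<And>cs. cs \<in> F \<Longrightarrow> cs \<noteq> [] \<and> distinct cs \<and> set (cycle_arcs cs) \<subseteq> E' \<and>
      label_product \<Gamma> w (cycle_arcs cs) = \<one>\<^bsub>\<Gamma>\<^esub>"
    "pairwise (\<lambda>cs cs'. set (cycle_arcs cs) \<inter> set (cycle_arcs cs') = {}) F"
    "card F \<ge> (\<Sum>x\<le>d. x div (25 * order \<Gamma>))" using Suc.IH by metis
  define G where "G = set (zero_sum_lists \<Gamma> w css)"
  have G: "cs \<in> set css" "label_product \<Gamma> w (cycle_arcs cs) = \<one>\<^bsub>\<Gamma>\<^esub>" if "cs \<in> G" for cs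
    using that by (auto simp: G_def zero_sum_lists_def)
  note arcs = cycle_listsD[OF css G(1)]
  have \<sigma>_arcs: "set (cycle_arcs cs) \<subseteq> (\<lambda>v. (v, \<sigma> v)) ` V" if "cs \<in> G" for cs
    using arcs(1,2)[OF that] by auto
  \<comment> \<open>Distinctness of the concatenation does not rule out repeated empty lists, so
    their absence enters here. It lets \<open>card G\<close> count all zero-sum lists.\<close>
  have "distinct css"
    using css unfolding cycle_lists_def distinct_concat_iff by (metis removeAll_id)
  then have "card G = length (zero_sum_lists \<Gamma> w css)"
    unfolding G_def zero_sum_lists_def by (intro distinct_card) simp
  then have card_G: "card G \<ge> T" using T by simp
  have sep: "set (cycle_arcs cs) \<inter> set (cycle_arcs cs') = {}" if "cs \<in> F" "cs' \<in> G" for cs cs'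
    using F(2)[OF that(1)] \<sigma>_arcs[OF that(2)] by (auto simp: E'_def)
  have disj: "F \<inter> G = {}"
  proof -
    have "cycle_arcs cs \<noteq> []" if "cs \<in> G" for cs using arcs(1,3)[OF that] by simp
    then show ?thesis using sep by fastforce
  qed
  have in_G: "set (cycle_arcs cs) \<inter> set (cycle_arcs cs') = {}"
    if "cs \<in> G" "cs' \<in> G" "cs \<noteq> cs'" for cs cs'
  proof -
    have "set cs \<inter> set cs' = {}"
      using css G(1)[OF that(1)] G(1)[OF that(2)] that(3)
      unfolding cycle_lists_def distinct_concat_iff by blast
    then show ?thesis using arcs(1)[OF that(1)] arcs(1)[OF that(2)] by auto
  qed
  show ?case
  proof (intro exI[of _ "F \<union> G"] conjI ballI)
    show "finite (F \<union> G)" using F(1) by (simp add: G_def)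
    show "pairwise (\<lambda>cs cs'. set (cycle_arcs cs) \<inter> set (cycle_arcs cs') = {}) (F \<union> G)"
      using F(3) sep in_G unfolding pairwise_def by (blast intro: Int_commute[THEN trans])
    have "card (F \<union> G) = card F + card G"
      using F(1) disj by (intro card_Un_disjoint) (auto simp: G_def)
    then show "card (F \<union> G) \<ge> (\<Sum>x\<le>Suc d. x div (25 * order \<Gamma>))"
      using F(4) card_G by (simp add: T_def)
    have "(\<lambda>v. (v, \<sigma> v)) ` V \<subseteq> E" using \<sigma> by (auto simp: cycle_factors_def)
    then have GE: "set (cycle_arcs cs) \<subseteq> E" if "cs \<in> G" for cs using \<sigma>_arcs[OF that] by blast
    fix cs assume cs: "cs \<in> F \<union> G"
    then show "cs \<noteq> []" "distinct cs" "label_product \<Gamma> w (cycle_arcs cs) = \<one>\<^bsub>\<Gamma>\<^esub>"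
      using F(2) arcs(3,4) G(2) by blast+
    show "set (cycle_arcs cs) \<subseteq> E" using F(2) GE cs by (auto simp: E'_def)
  qed
qed

text \<open>With \<open>q = d div c\<close>, count for each \<open>i\<close> from 1 to
  \<open>q\<close> the \<open>d + 1 - i * c\<close> values \<open>x <= d\<close> with
  \<open>x >= i * c\<close>. Doubling and working in the integers avoids division and truncated
  subtraction.\<close>

lemma double_sum_div:
  fixes c :: nat
  assumes "c > 0"
  shows "2 * int (\<Sum>x\<le>d. x div c) = int (d div c) * (2 * int d + 2 - int c - int (d div c) * int c)"
proof (induction d)
  case (Suc d)
  show ?case
  proof (cases "Suc d mod c = 0")
    case True
    then have q: "Suc d div c = Suc (d div c)" by (simp add: div_Suc)
    then have "int (Suc d) = int (Suc (d div c) * c)"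
      using True by (metis add.right_neutral div_mult_mod_eq)
    \<comment> \<open>A new multiple of \<open>c\<close> has just been reached, so \<open>d\<close>
      is one less than it.\<close>
    then have d: "int d = (int (d div c) + 1) * int c - 1" by (simp add: algebra_simps)
    have "2 * int (\<Sum>x\<le>Suc d. x div c) = 2 * int (\<Sum>x\<le>d. x div c) + 2 * int (Suc d div c)" by simp
    also have "\<dots> = int (d div c) * (2 * int d + 2 - int c - int (d div c) * int c) + 2 * (int (d div c) + 1)"
      unfolding Suc q by simp
    also have "\<dots> = (int (d div c) + 1) * (2 * (int d + 1) + 2 - int c - (int (d div c) + 1) * int c)"
      unfolding d by (simp add: algebra_simps)
    finally show ?thesis unfolding q by (simp add: add.commute)
  next
    case False
    then have "Suc d div c = d div c" by (simp add: div_Suc)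
    then show ?thesis using Suc by (simp add: algebra_simps)
  qed
qed simp

text \<open>Write \<open>d = q * c + r\<close>. The closed form exceeds \<open>d ^ 2\<close> by
  \<open>c^2 * q * (q - 2) + 4 * c * q + (2 * q * c * r - r^2)\<close>, and \<open>q >= 2\<close> is
  what \<open>2 * c <= d\<close> provides. With \<open>c = 25 * k\<close> this is the hypothesis
  \<open>d >= 50 * k\<close> of the theorem.\<close>

lemma sum_div_ge:
  fixes c :: nat
  assumes c: "c > 0" and d: "2 * c \<le> d"
  shows "d\<^sup>2 \<le> 4 * c * (\<Sum>x\<le>d. x div c)"
proof -
  define q r where "q = int (d div c)" and "r = int (d mod c)"
  have "d = d div c * c + d mod c" by simp
  then have dq: "int d = q * int c + r" unfolding q_def r_def by (metis of_nat_add of_nat_mult)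
  have q: "q \<ge> 2" using div_le_mono[OF d, of c] c by (simp add: q_def)
  have r: "0 \<le> r" "r \<le> int c" using c by (auto simp: r_def less_imp_le)
  have "r * r \<le> int c * r" using r by (intro mult_right_mono) auto
  also have "\<dots> \<le> q * int c * r"
    using mult_right_mono[of 1 q "int c"] q r by (intro mult_right_mono) auto
  also have "\<dots> \<le> q * int c * r + q * int c * r" using q r by simp
  finally have "r * r \<le> 2 * q * int c * r" by (simp add: mult_ac)
  moreover have "int c * int c * (q * (q - 2)) \<ge> 0" "4 * int c * q \<ge> 0" using q by auto
  moreover have "2 * int c * (q * (2 * int d + 2 - int c - q * int c)) - (int d)\<^sup>2 =
      int c * int c * (q * (q - 2)) + 4 * int c * q + (2 * q * int c * r - r * r)"
    unfolding dq power2_eq_square by (simp add: algebra_simps)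
  ultimately have "(int d)\<^sup>2 \<le> 2 * int c * (q * (2 * int d + 2 - int c - q * int c))" by linarith
  also have "\<dots> = int (4 * c * (\<Sum>x\<le>d. x div c))"
    using double_sum_div[OF c, of d] by (simp add: q_def)
  finally show ?thesis by (simp only: of_nat_le_iff flip: of_nat_power)
qed

section \<open>From vertex lists back to arc walks in the digraph\<close>

lemma (in pre_digraph) awalk_of_vertex_list:
  assumes "\<And>a. a \<in> set (zip (u # vs) (vs @ [y])) \<Longrightarrow> arc_to_ends G (f a) = a"
  shows "cas u (map f (zip (u # vs) (vs @ [y]))) y \<and>
    awalk_verts u (map f (zip (u # vs) (vs @ [y]))) = u # vs @ [y]"
  using assms
proof (induction vs arbitrary: u)
  case (Cons v vs)
  have "arc_to_ends G (f (u, v)) = (u, v)" using Cons.prems by simp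
  moreover have "cas v (map f (zip (v # vs) (vs @ [y]))) y \<and>
      awalk_verts v (map f (zip (v # vs) (vs @ [y]))) = v # vs @ [y]"
    using Cons.prems by (intro Cons.IH) auto
  ultimately show ?case by (simp add: arc_to_ends_def)
qed (simp add: arc_to_ends_def)

lemma (in pre_digraph) cycle_of_vertex_list:
  assumes cs: "cs \<noteq> []" "distinct cs"
    and f: "\<And>a. a \<in> set (cycle_arcs cs) \<Longrightarrow> f a \<in> arcs G \<and> arc_to_ends G (f a) = a"
    and "set cs \<subseteq> verts G"
  shows "cycle (map f (cycle_arcs cs))"
proof -
  obtain u vs where uv: "cs = u # vs" using cs by (cases cs) auto
  have arcs: "cycle_arcs cs = zip (u # vs) (vs @ [u])" by (simp add: cycle_arcs_def uv)
  have "cas u (map f (cycle_arcs cs)) u" "awalk_verts u (map f (cycle_arcs cs)) = u # vs @ [u]"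
    using awalk_of_vertex_list[of u vs u f] f unfolding arcs by auto
  moreover have "map f (cycle_arcs cs) \<noteq> []" by (simp add: arcs zip_eq_Nil_iff)
  ultimately show ?thesis
    using assms unfolding cycle_def awalk_def by (intro exI[of _ u]) (auto simp: uv)
qed

text \<open>Without parallel arcs, heads are injective on out-arcs and tails on in-arcs, so arc
  degrees count neighbours.\<close>

lemma regular_relation_arcs_ends:
  assumes "digraph D" "regular_digraph d D"
  shows "regular_relation (verts D) (arcs_ends D) d"
proof -
  interpret digraph D by fact
  have "{u. (v, u) \<in> arcs_ends D} = head D ` out_arcs D v" for v
    by (auto simp: arcs_ends_def arc_to_ends_def out_arcs_def)
  moreover have "inj_on (head D) (out_arcs D v)" for v
    by (rule inj_onI) (auto simp: out_arcs_def arc_to_ends_def intro!: no_multi_arcs)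
  moreover have "{u. (u, v) \<in> arcs_ends D} = tail D ` in_arcs D v" for v
    by (auto simp: arcs_ends_def arc_to_ends_def in_arcs_def)
  moreover have "inj_on (tail D) (in_arcs D v)" for v
    by (rule inj_onI) (auto simp: in_arcs_def arc_to_ends_def intro!: no_multi_arcs)
  moreover have "(v, v) \<notin> arcs_ends D" for v
    using no_loops by (auto simp: arcs_ends_def arc_to_ends_def)
  ultimately show ?thesis
    using assms(2) by (auto simp: regular_relation_def regular_digraph_def out_degree_def in_degree_def
        card_image arcs_ends_def arc_to_ends_def)
qed

theorem theorem4p2:
  fixes \<Gamma> :: "('g, 'm) monoid_scheme"
    and D :: "('v, 'e) pre_digraph"
    and w :: "'e \<Rightarrow> 'g"
    and d k :: nat
  assumes "group \<Gamma>"
    and "finite (carrier \<Gamma>)"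
    and "order \<Gamma> = k"
    and "k \<ge> 2"
    and "digraph D"
    and "verts D \<noteq> {}"
    and "regular_digraph d D"
    and "w \<in> arcs D \<rightarrow> carrier \<Gamma>"
    and "d \<ge> 50 * k"
  shows "\<exists>F. finite F \<and> (\<forall>p \<in> F. zero_sum_cycle \<Gamma> D w p) \<and> arc_disjoint F \<and>
           real (card F) \<ge> (real d)\<^sup>2 / (100 * real k)"
proof -
  interpret digraph D by fact
  define E where "E = arcs_ends D"
  \<comment> \<open>Picks an arc with given ends; the labelling is pulled back along it to pairs of
    vertices.\<close>
  define f where "f = inv_into (arcs D) (arc_to_ends D)"
  have f: "f a \<in> arcs D" "arc_to_ends D (f a) = a" if "a \<in> E" for a
    using that unfolding f_def E_def arcs_ends_def
    by (rule inv_into_into, intro f_inv_into_f)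
  have reg: "regular_relation (verts D) E d"
    unfolding E_def by (rule regular_relation_arcs_ends) fact+
  have wf: "w \<circ> f \<in> E \<rightarrow> carrier \<Gamma>" using assms(8) f by auto
  obtain F where F: "finite F" "\<And>cs. cs \<in> F \<Longrightarrow> cs \<noteq> [] \<and> distinct cs \<and> set (cycle_arcs cs) \<subseteq> E \<and>
      label_product \<Gamma> (w \<circ> f) (cycle_arcs cs) = \<one>\<^bsub>\<Gamma>\<^esub>"
    "pairwise (\<lambda>cs cs'. set (cycle_arcs cs) \<inter> set (cycle_arcs cs') = {}) F"
    "card F \<ge> (\<Sum>x\<le>d. x div (25 * k))"
    using disjoint_zero_sum_cycles[OF assms(1,2) _ assms(6) reg wf] assms(3,4) by metis
  define P where "P cs = map f (cycle_arcs cs)" for cs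
  have nonempty: "cycle_arcs cs \<noteq> []" if "cs \<in> F" for cs
  proof -
    have "cs \<noteq> []" using F(2)[OF that] by simp
    then show ?thesis by (simp add: cycle_arcs_def zip_eq_Nil_iff)
  qed
  have disj: "set (P cs) \<inter> set (P cs') = {}" if "cs \<in> F" "cs' \<in> F" "cs \<noteq> cs'" for cs cs'
  proof -
    have "set (cycle_arcs cs) \<inter> set (cycle_arcs cs') = {}" using F(3) that by (auto simp: pairwise_def)
    moreover have "inj_on f E" using f(2) by (metis inj_on_inverseI)
    moreover have "set (cycle_arcs cs) \<subseteq> E" "set (cycle_arcs cs') \<subseteq> E" using F(2) that by auto
    ultimately show ?thesis unfolding P_def set_map by (metis image_empty inj_on_image_Int)
  qed
  \<comment> \<open>Distinct vertex lists yield disjoint nonempty arc sets, so passing to arc lists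
    loses no cycle in the count.\<close>
  have inj: "inj_on P F"
  proof (rule inj_onI, rule ccontr)
    fix cs cs' assume *: "cs \<in> F" "cs' \<in> F" "P cs = P cs'" "cs \<noteq> cs'"
    then show False using disj[of cs cs'] nonempty[of cs'] by (simp add: P_def)
  qed
  have "zero_sum_cycle \<Gamma> D w (P cs)" if cs: "cs \<in> F" for cs
  proof -
    have sub: "set (cycle_arcs cs) \<subseteq> E" using F(2)[OF cs] by simp
    have "set cs = fst ` set (cycle_arcs cs)"
      unfolding cycle_arcs_def by (metis length_rotate1 list.set_map map_fst_zip)
    also have "\<dots> \<subseteq> verts D" using sub reg by (auto simp: regular_relation_def)
    finally have "cycle (P cs)"
      unfolding P_def using F(2)[OF cs] sub f by (intro cycle_of_vertex_list) auto
    moreover have "label_product \<Gamma> w (P cs) = \<one>\<^bsub>\<Gamma>\<^esub>"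
      using F(2)[OF cs] by (simp add: P_def label_product_def)
    ultimately show ?thesis by (simp add: zero_sum_cycle_def)
  qed
  moreover have "arc_disjoint (P ` F)"
    unfolding arc_disjoint_def pairwise_def using disj by blast
  moreover have "real (card (P ` F)) \<ge> (real d)\<^sup>2 / (100 * real k)"
  proof -
    have "d\<^sup>2 \<le> 4 * (25 * k) * (\<Sum>x\<le>d. x div (25 * k))"
      using assms(4,9) by (intro sum_div_ge) auto
    also have "\<dots> \<le> 4 * (25 * k) * card (P ` F)"
      using F(4) by (intro mult_left_mono) (auto simp: card_image[OF inj])
    finally have "real (d\<^sup>2) \<le> real (4 * (25 * k) * card (P ` F))" by (rule of_nat_mono)
    then show ?thesis using assms(4) by (simp add: divide_le_eq mult_ac)
  qed
  ultimately show ?thesis using F(1) by (intro exI[of _ "P ` F"]) auto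
qed

end
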